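(* Let $t_0\ge 0$ and let $a,b,g,h:[0,\infty)\to\mathbb R$ be Lebesgue measurable functions such that $a,b$ are essentially bounded on $[0,\infty)$; $|a(t)|\le a_0$ for $t\ge t_0$ with a constant $a_0<1$; $b(t)\ge 0$, and $b(t)\ge\beta>0$ for $t\ge t_0$ with a constant $\beta$; $g(t)\le t$, $h(t)\le t$, $\lim_{t\to\infty}g(t)=\lim_{t\to\infty}h(t)=\infty$; the set $g^{-1}(E)$ has Lebesgue measure zero whenever $E\subset\mathbb R$ has Lebesgue measure zero; and $t-g(t)\le\delta$, $t-h(t)\le\tau$ for $t\ge t_0$ with constants $\delta>0$, $\tau>0$. Let $B(t,s)$ be a measurable function on $[0,\infty)\times[0,\infty)$ such that $B(t,\cdot)$ is left continuous and non-decreasing for almost all $t$, $B(\cdot,s)$ is locally integrable for any $s$, $B(t,h(t))=0$ and $B(t,t^+)=1$. Assume that at least one of the following conditions holds: (i) $\displaystyle\int_{h(t)}^t b(s)\,ds\le\frac1e$ for $t\ge t_0$, and $\displaystyle\|a\|_{[t_0,\infty)}+\|b\|_{[t_0,\infty)}\left\|\frac ab\right\|_{[t_0,\infty)}<1$; (ii) $\displaystyle\left\|\frac{a}{b_0}\right\|_{[t_0,\infty)}\frac{\|b\|_{[t_0,\infty)}}{1-\|a\|_{[t_0,\infty)}}+\left\|\frac{b-b_0}{b_0}\right\|_{[t_0,\infty)}<1$, where $b_0(t)=\min\left\{b(t),\frac1{\tau e}\right\}$; (iii) $\displaystyle\|b\|_{[t_0,\infty)}\left(\left\|\frac ab\right\|_{[t_0,\infty)}+\left\|\left(t-h(t)-\frac1{\|b\|_{[t_0,\infty)}e}\right)^+\right\|_{[t_0,\infty)}\right)<1-\|a\|_{[t_0,\infty)}$.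 Then the equation $$\dot x(t)-a(t)\dot x(g(t))+b(t)\int_{h(t)}^t x(s)\,d_sB(t,s)=0$$ is exponentially stable.
   Context: Notation: $\|f\|_{[t_0,\infty)}=\operatorname{ess\,sup}_{t\ge t_0}|f(t)|$ (an expression in $t$ inside the norm denotes the corresponding function of $t$); $u^+=\max\{u,0\}$. In integrals $\int_{h(t)}^t b(s)\,ds$ the coefficient $b$ is taken to be $0$ at negative arguments; likewise $B(t,s)=0$ for $s<0$. The integral $\int_{h(t)}^t x(s)\,d_sB(t,s)$ is the Lebesgue–Stieltjes integral over the closed interval $[h(t),t]$ (so a jump of $B(t,\cdot)$ at $s=t$ is included) and $\int_{h(t)}^t d_sB(t,s)=1$. Solutions: for an initial point $\sigma\ge t_0$ and bounded Borel measurable functions $\varphi:(-\infty,\sigma]\to\mathbb R$, $\psi:(-\infty,\sigma)\to\mathbb R$ (prescribed independently of each other), a solution of the equation with initial conditions $x(t)=\varphi(t)$ for $t\le\sigma$, $\dot x(t)=\psi(t)$ for $t<\sigma$ is a function $x$ that is absolutely continuous on each $[\sigma,c]$, has locally essentially bounded derivative on $[\sigma,\infty)$, and satisfies the equation for almost all $t\ge\sigma$, where $x$ at arguments $\le\sigma$ is replaced by $\varphi$ and $\dot x$ at arguments $<\sigma$ is replaced by $\psi$. The equation is (uniformly) exponentially stable if there exist $M>0$, $\gamma>0$, not depending on $\sigma\ge t_0$, $\varphi$, $\psi$, such that every such solution satisfies $|x(t)|\le M e^{-\gamma(t-\sigma)}\sup_{s\le\sigma}(|\varphi(s)|+|\psi(s)|)$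 for $t\ge\sigma$ (with $\psi(\sigma):=0$). *)

theory Defs
  imports "HOL-Probability.Essential_Supremum"
begin

text \<open>
  Functions given on a half-line only are encoded as total functions on the reals whose values
  off the half-line are never used; this operator realises the convention that the coefficient
  \<open>b\<close> and the kernel \<open>B t\<close> vanish at negative arguments.
\<close>

definition zero_ext :: "(real \<Rightarrow> real) \<Rightarrow> real \<Rightarrow> real" where
  "zero_ext f s = (if s < 0 then 0 else f s)"

definition ess_bounded_on :: "real set \<Rightarrow> (real \<Rightarrow> real) \<Rightarrow> bool" where
  "ess_bounded_on S f \<longleftrightarrow> (\<exists>C. AE t in lebesgue_on S. \<bar>f t\<bar> \<le> C)"

text \<open>
  The result is a real number, so it is meaningful only for measurable, essentially bounded
  functions (an infinite essential supremum would be sent to 0). All norms in the theorem are of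
  such functions: \<open>a\<close>, \<open>b\<close> and \<open>t - h t\<close> are bounded on \<open>{t0..}\<close>, and every denominator
  is bounded below there by a positive constant.
\<close>

definition ess_norm :: "real \<Rightarrow> (real \<Rightarrow> real) \<Rightarrow> real" where
  "ess_norm t0 f = real_of_ereal (esssup (lebesgue_on {t0..}) (\<lambda>t. ereal \<bar>f t\<bar>))"

definition abs_cont_Icc :: "real \<Rightarrow> real \<Rightarrow> (real \<Rightarrow> real) \<Rightarrow> bool" where
  "abs_cont_Icc c d f \<longleftrightarrow>
     (\<forall>\<epsilon>>0. \<exists>\<delta>>0. \<forall>(n::nat) u v.
        (\<forall>i<n. c \<le> u i \<and> u i \<le> v i \<and> v i \<le> d) \<and>
        disjoint_family_on (\<lambda>i. {u i<..<v i}) {..<n} \<and>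
        (\<Sum>i<n. v i - u i) < \<delta> \<longrightarrow>
        (\<Sum>i<n. \<bar>f (v i) - f (u i)\<bar>) < \<epsilon>)"

text \<open>
  The Lebesgue--Stieltjes measure of \<open>F\<close> on the closed interval from \<open>c\<close> to \<open>d\<close>, for \<open>F\<close>
  non-decreasing on \<open>{c..}\<close> with \<open>F(c-) = F c\<close>. Since \<open>interval_measure\<close> expects a
  right-continuous distribution function on the whole line, \<open>F\<close> is replaced by its right limits
  and frozen outside the interval. The atoms at both end points are kept: the one at \<open>c\<close> is
  \<open>F(c+) - F c\<close>, the one at \<open>d > c\<close> is \<open>F(d+) - F(d-)\<close>.
\<close>

definition stieltjes_Icc :: "(real \<Rightarrow> real) \<Rightarrow> real \<Rightarrow> real \<Rightarrow> real measure" where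
  "stieltjes_Icc F c d =
     interval_measure (\<lambda>s. if s < c then F c else Lim (at_right (min s d)) F)"

lemma emeasure_stieltjes_Icc:
  assumes "c \<le> d" and mono: "mono_on {c..} F"
  shows "emeasure (stieltjes_Icc F c d) {c..d} = ennreal (Lim (at_right d) F - F c)"
    and "emeasure (stieltjes_Icc F c d) (- {c..d}) = 0"
proof -
  define R where "R s = Inf (F ` {s<..})" for s
  have F_le: "F x \<le> F y" if "c \<le> x" "x \<le> y" for x y
    using mono that by (auto simp: mono_on_def)
  have bdd: "bdd_below (F ` {s<..})" if "c \<le> s" for s
    using that by (auto intro!: bdd_belowI[of _ "F c"] F_le)
  have R_le: "R s \<le> F y" if "c \<le> s" "s < y" for s y
    unfolding R_def using that by (intro cINF_lower[OF bdd]) auto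
  have R_ge: "m \<le> R s" if "\<And>y. s < y \<Longrightarrow> m \<le> F y" for s m
    unfolding R_def using that by (intro cINF_greatest) auto
  have ev: "\<forall>\<^sub>F y in at_right s. F y < z \<and> R s \<le> R y \<and> R y < z" if "c \<le> s" "R s < z" for s z
  proof -
    have "\<exists>w\<in>{s<..}. F w < z"
      using that(2) cINF_less_iff[OF _ bdd[OF that(1)], of z] unfolding R_def by simp
    then obtain w where w: "s < w" "F w < z" by auto
    have "F y < z \<and> R s \<le> R y \<and> R y < z" if "s < y" "y < w" for y
      using w that F_le[of y w] R_le[of y w] \<open>c \<le> s\<close>
      by (auto intro!: R_ge R_le[of s])
    then show ?thesis
      using w(1) unfolding eventually_at_right[OF w(1)] by blast
  qed
  have lim: "(F \<longlongrightarrow> R s) (at_right s)" if "c \<le> s" for s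
  proof (rule order_tendstoI)
    fix z assume "z < R s"
    then show "\<forall>\<^sub>F y in at_right s. z < F y"
      unfolding eventually_at_filter
      using R_le[OF that] by (intro always_eventually) (auto intro: less_le_trans)
  next
    fix z assume "R s < z"
    from ev[OF that this] show "\<forall>\<^sub>F y in at_right s. F y < z"
      by eventually_elim auto
  qed
  have Rlim: "(R \<longlongrightarrow> R s) (at_right s)" if "c \<le> s" for s
  proof (rule order_tendstoI)
    fix z assume "z < R s"
    have "\<forall>\<^sub>F y in at_right s. R s \<le> R y"
      using ev[OF that, of "R s + 1"] by (simp add: eventually_conj_iff)
    then show "\<forall>\<^sub>F y in at_right s. z < R y"
      by (rule eventually_mono) (use \<open>z < R s\<close> in auto)
  next
    fix z assume "R s < z"
    from ev[OF that this] show "\<forall>\<^sub>F y in at_right s. R y < z"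
      by eventually_elim auto
  qed
  have Lim_R: "Lim (at_right s) F = R s" if "c \<le> s" for s
    using lim[OF that] by (intro tendsto_Lim) auto
  define G where "G s = (if s < c then F c else Lim (at_right (min s d)) F)" for s
  have G_R: "G s = R (min s d)" if "c \<le> s" for s
    using that \<open>c \<le> d\<close> by (simp add: G_def Lim_R)
  have R_mono: "R s \<le> R t" if "c \<le> s" "s \<le> t" for s t
    using that by (intro R_ge R_le) auto
  have G_mono: "G s \<le> G t" if "s \<le> t" for s t
  proof (cases "s < c")
    case True
    then show ?thesis
      using \<open>c \<le> d\<close> by (cases "t < c") (auto simp: G_R G_def[of s] G_def[of t] Lim_R intro!: R_ge F_le)
  next
    case False
    then show ?thesis
      using that \<open>c \<le> d\<close> by (simp add: G_R R_mono)
  qed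
  have G_cont: "continuous (at_right s) G" for s
  proof -
    consider "s < c" | "c \<le> s" "s < d" | "c \<le> s" "d \<le> s" by linarith
    then show ?thesis
    proof cases
      case 1
      have "\<forall>\<^sub>F y in at_right s. G y = G s"
        unfolding eventually_at_right[OF 1] using 1 by (auto simp: G_def)
      then show ?thesis
        by (simp add: continuous_within tendsto_eventually)
    next
      case 2
      have "\<forall>\<^sub>F y in at_right s. R y = G y"
        unfolding eventually_at_right[OF 2(2)] using 2 by (auto simp: G_R)
      moreover have "G s = R s"
        using 2 by (simp add: G_R)
      ultimately show ?thesis
        using Rlim[OF 2(1)] by (simp add: continuous_within) (metis Lim_transform_eventually)
    next
      case 3
      have "\<forall>\<^sub>F y in at_right s. G y = G s"
        unfolding eventually_at_filter using 3 by (auto simp: G_R)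
      then show ?thesis
        by (simp add: continuous_within tendsto_eventually)
    qed
  qed
  define N where "N = interval_measure G"
  have N: "stieltjes_Icc F c d = N"
    by (simp add: stieltjes_Icc_def N_def G_def[abs_def])
  have [measurable_cong, simp]: "sets N = sets borel" by (simp add: N_def)
  have Ioc: "emeasure N {u<..v} = ennreal (G v - G u)" if "u \<le> v" for u v
    unfolding N_def using that G_mono G_cont by (rule emeasure_interval_measure_Ioc)
  have below: "{..<c} \<in> null_sets N"
  proof -
    have "(\<Union>n::nat. {c - real n - 1 <.. c - 1 / (real n + 1)}) \<in> null_sets N"
      by (intro null_sets_UN null_setsI) (auto simp: Ioc G_def field_simps)
    moreover have "{..<c} \<subseteq> (\<Union>n::nat. {c - real n - 1 <.. c - 1 / (real n + 1)})"
    proof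
      fix x assume "x \<in> {..<c}"
      then have "c - x > 0" by simp
      obtain n :: nat where n: "max (c - x) (1 / (c - x)) < real n"
        using reals_Archimedean2 by blast
      then have "1 / (c - x) < real n + 1" by simp
      then have "1 / (real n + 1) < c - x"
        using \<open>c - x > 0\<close> by (simp add: field_simps)
      then show "x \<in> (\<Union>n::nat. {c - real n - 1 <.. c - 1 / (real n + 1)})"
        using n by (intro UN_I[of n]) auto
    qed
    ultimately show ?thesis
      using null_sets_subset[of _ N] by simp
  qed
  have above: "{d<..} \<in> null_sets N"
  proof -
    have "(\<Union>n::nat. {d <.. d + real n}) \<in> null_sets N"
      using \<open>c \<le> d\<close> by (intro null_sets_UN null_setsI) (auto simp: Ioc G_R)
    moreover have "{d<..} \<subseteq> (\<Union>n::nat. {d <.. d + real n})"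
    proof
      fix x assume "x \<in> {d<..}"
      moreover obtain n :: nat where "x - d < real n"
        using reals_Archimedean2 by blast
      ultimately show "x \<in> (\<Union>n::nat. {d <.. d + real n})"
        by (intro UN_I[of n]) auto
    qed
    ultimately show ?thesis
      using null_sets_subset[of _ N] by simp
  qed
  have "- {c..d} = {..<c} \<union> {d<..}" by auto
  then show "emeasure (stieltjes_Icc F c d) (- {c..d}) = 0"
    unfolding N using null_setsD1[OF null_sets.Un[OF below above]] by simp
  have "emeasure N {c..d} = emeasure N ({c - 1<..d} - {..<c})"
    using \<open>c \<le> d\<close> by (intro arg_cong2[where f = emeasure]) auto
  also have "\<dots> = emeasure N {c - 1<..d}"
    using below by (intro emeasure_Diff_null_set) auto
  also have "\<dots> = ennreal (Lim (at_right d) F - F c)"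
    using \<open>c \<le> d\<close> by (simp add: Ioc G_def)
  finally show "emeasure (stieltjes_Icc F c d) {c..d} = ennreal (Lim (at_right d) F - F c)"
    unfolding N .
qed

definition initial_data :: "real \<Rightarrow> (real \<Rightarrow> real) \<Rightarrow> (real \<Rightarrow> real) \<Rightarrow> bool" where
  "initial_data \<sigma> \<phi> \<psi> \<longleftrightarrow>
     \<phi> \<in> borel_measurable (restrict_space borel {..\<sigma>}) \<and> bounded (\<phi> ` {..\<sigma>}) \<and>
     \<psi> \<in> borel_measurable (restrict_space borel {..<\<sigma>}) \<and> bounded (\<psi> ` {..<\<sigma>})"

text \<open>
  The derivative entering the equation: \<open>\<psi>\<close> before \<open>\<sigma>\<close>, the derivative of \<open>x\<close> afterwards.
\<close>

definition deriv_from :: "real \<Rightarrow> (real \<Rightarrow> real) \<Rightarrow> (real \<Rightarrow> real) \<Rightarrow> real \<Rightarrow> real" where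
  "deriv_from \<sigma> \<psi> x t = (if t < \<sigma> then \<psi> t else deriv x t)"

text \<open>
  A solution is carried as a function on the whole line that coincides with \<open>\<phi>\<close> up to \<open>\<sigma>\<close>.
  The two-sided derivative at \<open>\<sigma>\<close> itself, which need not exist, is irrelevant: it only affects
  a null set of \<open>t\<close> because \<open>g\<close> pulls null sets back to null sets.
\<close>

definition is_solution ::
  "(real \<Rightarrow> real) \<Rightarrow> (real \<Rightarrow> real) \<Rightarrow> (real \<Rightarrow> real) \<Rightarrow> (real \<Rightarrow> real) \<Rightarrow> (real \<Rightarrow> real \<Rightarrow> real) \<Rightarrow>
   real \<Rightarrow> (real \<Rightarrow> real) \<Rightarrow> (real \<Rightarrow> real) \<Rightarrow> (real \<Rightarrow> real) \<Rightarrow> bool" where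
  "is_solution a b g h B \<sigma> \<phi> \<psi> x \<longleftrightarrow>
     (\<forall>t\<le>\<sigma>. x t = \<phi> t) \<and>
     (\<forall>c\<ge>\<sigma>. abs_cont_Icc \<sigma> c x) \<and>
     (\<forall>c\<ge>\<sigma>. (AE t in lebesgue_on {\<sigma>..c}. x differentiable (at t)) \<and>
             ess_bounded_on {\<sigma>..c} (deriv x)) \<and>
     (AE t in lebesgue_on {\<sigma>..}.
        deriv_from \<sigma> \<psi> x t - a t * deriv_from \<sigma> \<psi> x (g t)
          + b t * (LINT s:{h t..t}|stieltjes_Icc (zero_ext (B t)) (h t) t. x s) = 0)"

definition exponentially_stable ::
  "real \<Rightarrow> (real \<Rightarrow> real) \<Rightarrow> (real \<Rightarrow> real) \<Rightarrow> (real \<Rightarrow> real) \<Rightarrow> (real \<Rightarrow> real) \<Rightarrow>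
   (real \<Rightarrow> real \<Rightarrow> real) \<Rightarrow> bool" where
  "exponentially_stable t0 a b g h B \<longleftrightarrow>
     (\<exists>M>0. \<exists>\<gamma>>0. \<forall>\<sigma>\<ge>t0. \<forall>\<phi> \<psi> x.
        initial_data \<sigma> \<phi> \<psi> \<longrightarrow> is_solution a b g h B \<sigma> \<phi> \<psi> x \<longrightarrow>
        (\<forall>t\<ge>\<sigma>. \<bar>x t\<bar> \<le> M * exp (- \<gamma> * (t - \<sigma>)) *
                  (SUP s\<in>{..\<sigma>}. \<bar>\<phi> s\<bar> + \<bar>if s < \<sigma> then \<psi> s else 0\<bar>)))"

end

theory Submission
  imports Defs "HOL-Probability.Probability_Measure"
begin

text \<open>
  The delays being bounded, no Bohl--Perron theorem is needed: exponentially weighted a priori bounds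
  close up directly. Writing the equation as \<open>x' + c L x = F\<close>, where the average \<open>L\<close> only looks back
  so far that \<open>c\<close> integrates to at most \<open>1 / e\<close>, the comparison principle for \<open>x' + c L x\<close> bounds \<open>x\<close>
  by \<open>F / c\<close>, hence by \<open>x'\<close> and (in case (ii)) a multiple less than one of \<open>x\<close>; the equation bounds
  \<open>x'\<close> by \<open>x\<close>; and each of the three conditions says that these two bounds compose to a contraction.
  This persists under the weight \<open>exp (\<gamma> (t - \<sigma>))\<close> for small \<open>\<gamma>\<close>. The comparison is made with the
  history of \<open>x\<close> replaced by the constant \<open>x \<sigma>\<close>, which changes \<open>F\<close> only on a time interval of
  bounded length.
\<close>

section \<open>Absolutely continuous functions\<close>

text \<open>All estimates are made on a bounded interval from \<sigma> to T, where the weighted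
  suprema Y of |x| and Z of |x'| are finite because x is continuous with essentially bounded
  derivative. The constants obtained depend on neither T nor \<sigma>, so no growth bound for
  solutions has to be known beforehand. Up to initial data and a factor \<rho> close to 1, the
  equation yields Z \<le> \<alpha> Z + \<omega> Y and the comparison yields Y \<le> (p1 + p2) Z + q
  Y. Here p1 bounds |a| / c, q bounds (b - c) / c, and p2 bounds the part of the delay that is cut
  off so that c integrates to at most 1 / e over the rest. Eliminating Z leaves (p1 + p2) \<omega> /
  (1 - \<alpha>) + q < 1, which specialises to each condition. Cutting off a delay costs an
  increment of x, paid for by x'; before \<sigma> there is no such control, since \<phi> is merely
  bounded and \<psi> is unrelated to it. The constant history restores it. The factor \<rho> absorbs
  two losses caused by the weight: exp (\<gamma> d) for looking back by d, and 1 / (1 - \<gamma> /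
  \<kappa>) in the comparison, where \<kappa> is a lower bound of c.\<close>

definition ac_family :: "real set \<Rightarrow> real \<Rightarrow> real \<Rightarrow> nat \<Rightarrow> (nat \<Rightarrow> real) \<Rightarrow> (nat \<Rightarrow> real) \<Rightarrow> bool" where
  "ac_family U c t n u v \<longleftrightarrow>
     (\<forall>i<n. c \<le> u i \<and> u i \<le> v i \<and> v i \<le> t \<and> {u i<..<v i} \<subseteq> U) \<and>
     disjoint_family_on (\<lambda>i. {u i<..<v i}) {..<n}"

text \<open>These families compete for the variation of a function over the part of \<open>U\<close>
  between \<open>c\<close> and \<open>t\<close>. Bounding their total length by the measure of
  \<open>U\<close> brings all of them below the \<delta> of absolute continuity at once when that
  measure is small.\<close>

lemma ac_family_length_le:
  assumes "ac_family U c t n u v" "U \<in> lmeasurable"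
  shows "(\<Sum>i<n. v i - u i) \<le> measure lebesgue U"
proof -
  have "(\<Sum>i<n. v i - u i) = (\<Sum>i<n. measure lebesgue {u i<..<v i})"
    using assms(1) by (intro sum.cong) (auto simp: ac_family_def)
  also have "\<dots> = measure lebesgue (\<Union>i<n. {u i<..<v i})"
    using assms(1)
    by (intro measure_finite_Union[symmetric]) (auto simp: ac_family_def)
  also have "\<dots> \<le> measure lebesgue U"
    using assms by (intro measure_mono_fmeasurable) (auto simp: ac_family_def)
  finally show ?thesis .
qed

lemma ac_family_snoc:
  assumes "ac_family U c t n u v" "c \<le> t" "t \<le> s" "{t<..<s} \<subseteq> U"
  shows "ac_family U c s (Suc n) (u(n := t)) (v(n := s))"
  using assms unfolding ac_family_def disjoint_family_on_def
  by (auto simp: less_Suc_eq)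

section \<open>Elementary properties of absolute continuity\<close>

lemma abs_cont_Icc_continuous_on:
  assumes "abs_cont_Icc c d f"
  shows "continuous_on {c..d} f"
proof -
  have "\<exists>\<delta>>0. \<forall>y\<in>{c..d}. dist y x < \<delta> \<longrightarrow> dist (f y) (f x) < e" if x: "x \<in> {c..d}" and "e > 0" for x e
  proof -
    obtain \<delta> where "\<delta> > 0" and \<delta>: "\<And>(n::nat) u v. (\<forall>i<n. c \<le> u i \<and> u i \<le> v i \<and> v i \<le> d) \<Longrightarrow>
        disjoint_family_on (\<lambda>i. {u i<..<v i}) {..<n} \<Longrightarrow>
        (\<Sum>i<n. v i - u i) < \<delta> \<Longrightarrow> (\<Sum>i<n. \<bar>f (v i) - f (u i)\<bar>) < e"
      using assms \<open>e > 0\<close> unfolding abs_cont_Icc_def by meson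
    have "dist (f y) (f x) < e" if "y \<in> {c..d}" "dist y x < \<delta>" for y
      using \<delta>[of 1 "\<lambda>_. min x y" "\<lambda>_. max x y"] x that
      by (cases "x \<le> y") (auto simp: dist_real_def disjoint_family_on_def)
    then show ?thesis using \<open>\<delta> > 0\<close> by blast
  qed
  then show ?thesis unfolding continuous_on_iff by blast
qed

lemma abs_cont_Icc_subset:
  assumes "abs_cont_Icc c d f" "c \<le> c'" "d' \<le> d"
  shows "abs_cont_Icc c' d' f"
  using assms unfolding abs_cont_Icc_def by (meson order_trans)

lemma abs_cont_Icc_cong:
  assumes "abs_cont_Icc c d f" and eq: "\<And>t. c \<le> t \<Longrightarrow> t \<le> d \<Longrightarrow> g t = f t"
  shows "abs_cont_Icc c d g"
proof -
  have "(\<Sum>i<n. \<bar>g (v i) - g (u i)\<bar>) = (\<Sum>i<n. \<bar>f (v i) - f (u i)\<bar>)"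
    if uv: "\<forall>i<n. c \<le> u i \<and> u i \<le> v i \<and> v i \<le> d" for n :: nat and u v
  proof (rule sum.cong)
    fix i assume "i \<in> {..<n}"
    then have "c \<le> u i" "u i \<le> v i" "v i \<le> d" using uv by auto
    then show "\<bar>g (v i) - g (u i)\<bar> = \<bar>f (v i) - f (u i)\<bar>" using eq by auto
  qed simp
  with assms(1) show ?thesis unfolding abs_cont_Icc_def by (simp cong: conj_cong)
qed

lemma lipschitz_imp_abs_cont_Icc:
  assumes "K-lipschitz_on {c..d} f"
  shows "abs_cont_Icc c d f"
  unfolding abs_cont_Icc_def
proof (intro allI impI)
  fix \<epsilon> :: real assume "\<epsilon> > 0"
  have K: "K \<ge> 0" using assms by (rule lipschitz_on_nonneg)
  show "\<exists>\<delta>>0. \<forall>(n::nat) u v.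
        (\<forall>i<n. c \<le> u i \<and> u i \<le> v i \<and> v i \<le> d) \<and>
        disjoint_family_on (\<lambda>i. {u i<..<v i}) {..<n} \<and>
        (\<Sum>i<n. v i - u i) < \<delta> \<longrightarrow> (\<Sum>i<n. \<bar>f (v i) - f (u i)\<bar>) < \<epsilon>"
  proof (intro exI conjI allI impI; (elim conjE)?)
    \<comment> \<open>\<open>K + 1\<close> instead of \<open>K\<close>: for \<open>K = 0\<close> the
      quotient would be 0 and could not serve as a positive \<delta>.\<close>
    show "\<epsilon> / (K + 1) > 0" using K \<open>\<epsilon> > 0\<close> by simp
    fix n :: nat and u v :: "nat \<Rightarrow> real"
    assume uv: "\<forall>i<n. c \<le> u i \<and> u i \<le> v i \<and> v i \<le> d" and small: "(\<Sum>i<n. v i - u i) < \<epsilon> / (K + 1)"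
    have "\<bar>f (v i) - f (u i)\<bar> \<le> (K + 1) * (v i - u i)" if "i < n" for i
    proof -
      have "c \<le> u i" "u i \<le> v i" "v i \<le> d" using uv that by auto
      then have "\<bar>f (v i) - f (u i)\<bar> \<le> K * \<bar>v i - u i\<bar>"
        using lipschitz_onD[OF assms, of "v i" "u i"] by (simp add: dist_real_def)
      with \<open>u i \<le> v i\<close> show ?thesis by (simp add: algebra_simps)
    qed
    then have "(\<Sum>i<n. \<bar>f (v i) - f (u i)\<bar>) \<le> (K + 1) * (\<Sum>i<n. v i - u i)"
      unfolding sum_distrib_left by (intro sum_mono) simp
    also have "\<dots> < \<epsilon>"
      using small K by (simp add: pos_less_divide_eq mult.commute)
    finally show "(\<Sum>i<n. \<bar>f (v i) - f (u i)\<bar>) < \<epsilon>" .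
  qed
qed

lemma abs_cont_Icc_add:
  assumes "abs_cont_Icc c d f" "abs_cont_Icc c d g"
  shows "abs_cont_Icc c d (\<lambda>t. f t + g t)"
  unfolding abs_cont_Icc_def
proof (intro allI impI)
  fix \<epsilon> :: real assume "\<epsilon> > 0"
  then have "\<epsilon> / 2 > 0" by simp
  obtain \<delta>1 where 1: "\<delta>1 > 0" "\<And>(n::nat) u v. (\<forall>i<n. c \<le> u i \<and> u i \<le> v i \<and> v i \<le> d) \<Longrightarrow>
        disjoint_family_on (\<lambda>i. {u i<..<v i}) {..<n} \<Longrightarrow>
        (\<Sum>i<n. v i - u i) < \<delta>1 \<Longrightarrow> (\<Sum>i<n. \<bar>f (v i) - f (u i)\<bar>) < \<epsilon> / 2"
    using assms(1) \<open>\<epsilon> / 2 > 0\<close> unfolding abs_cont_Icc_def by meson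
  obtain \<delta>2 where 2: "\<delta>2 > 0" "\<And>(n::nat) u v. (\<forall>i<n. c \<le> u i \<and> u i \<le> v i \<and> v i \<le> d) \<Longrightarrow>
        disjoint_family_on (\<lambda>i. {u i<..<v i}) {..<n} \<Longrightarrow>
        (\<Sum>i<n. v i - u i) < \<delta>2 \<Longrightarrow> (\<Sum>i<n. \<bar>g (v i) - g (u i)\<bar>) < \<epsilon> / 2"
    using assms(2) \<open>\<epsilon> / 2 > 0\<close> unfolding abs_cont_Icc_def by meson
  show "\<exists>\<delta>>0. \<forall>(n::nat) u v.
        (\<forall>i<n. c \<le> u i \<and> u i \<le> v i \<and> v i \<le> d) \<and>
        disjoint_family_on (\<lambda>i. {u i<..<v i}) {..<n} \<and>
        (\<Sum>i<n. v i - u i) < \<delta> \<longrightarrow> (\<Sum>i<n. \<bar>f (v i) + g (v i) - (f (u i) + g (u i))\<bar>) < \<epsilon>"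
  proof (intro exI conjI allI impI; (elim conjE)?)
    show "min \<delta>1 \<delta>2 > 0" using 1 2 by simp
    fix n :: nat and u v :: "nat \<Rightarrow> real"
    assume uv: "\<forall>i<n. c \<le> u i \<and> u i \<le> v i \<and> v i \<le> d"
      "disjoint_family_on (\<lambda>i. {u i<..<v i}) {..<n}" "(\<Sum>i<n. v i - u i) < min \<delta>1 \<delta>2"
    have "(\<Sum>i<n. \<bar>f (v i) + g (v i) - (f (u i) + g (u i))\<bar>)
        \<le> (\<Sum>i<n. \<bar>f (v i) - f (u i)\<bar> + \<bar>g (v i) - g (u i)\<bar>)"
      by (intro sum_mono) linarith
    also have "\<dots> < \<epsilon>"
      using 1(2)[OF uv(1,2)] 2(2)[OF uv(1,2)] uv(3) by (simp add: sum.distrib)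
    finally show "(\<Sum>i<n. \<bar>f (v i) + g (v i) - (f (u i) + g (u i))\<bar>) < \<epsilon>" .
  qed
qed

lemma abs_cont_Icc_minus:
  assumes "abs_cont_Icc c d f"
  shows "abs_cont_Icc c d (\<lambda>t. - f t)"
  using assms unfolding abs_cont_Icc_def by (simp add: abs_minus_commute)

text \<open>
  Cover \<open>N\<close> by an open set \<open>U\<close> of small measure and let \<open>V t\<close> be the variation of \<open>f\<close> over
  \<open>U \<inter> [c, t]\<close>, small by absolute continuity. Then \<open>f t + e (t - c) + V t\<close> can be continued to the
  right from every point without decreasing: outside \<open>N\<close> by the Dini condition, inside by \<open>V\<close>.
\<close>

lemma abs_cont_Icc_le:
  fixes f :: "real \<Rightarrow> real"
  assumes "c \<le> d" and ac: "abs_cont_Icc c d f" and N: "negligible N"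
    and dini: "\<And>t e. c \<le> t \<Longrightarrow> t < d \<Longrightarrow> t \<notin> N \<Longrightarrow> 0 < e \<Longrightarrow>
      \<forall>\<^sub>F s in at_right t. - e * (s - t) \<le> f s - f t"
  shows "f c \<le> f d"
proof (rule field_le_epsilon)
  fix e0 :: real assume "e0 > 0"
  \<comment> \<open>The denominator leaves room for two errors, the slope term
    \<open>e * (d - c)\<close> and the variation \<open>V d \<le> e\<close>, which together make up
    \<open>e0\<close>.\<close>
  define e where "e = e0 / (d - c + 1)"
  have "e > 0" using \<open>e0 > 0\<close> \<open>c \<le> d\<close> by (simp add: e_def)
  have "e * (d - c + 1) = e0" using \<open>c \<le> d\<close> by (simp add: e_def)
  then have e0: "e * (d - c) + e = e0" by (simp add: distrib_left)
  obtain \<delta> where "\<delta> > 0" and \<delta>: "\<And>(n::nat) u v. (\<forall>i<n. c \<le> u i \<and> u i \<le> v i \<and> v i \<le> d) \<Longrightarrow>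
        disjoint_family_on (\<lambda>i. {u i<..<v i}) {..<n} \<Longrightarrow>
        (\<Sum>i<n. v i - u i) < \<delta> \<Longrightarrow> (\<Sum>i<n. \<bar>f (v i) - f (u i)\<bar>) < e"
    using ac \<open>e > 0\<close> unfolding abs_cont_Icc_def by meson
  have N0: "N \<in> null_sets lebesgue" using N by (simp add: negligible_iff_null_sets)
  \<comment> \<open>Outer regularity controls \<open>U - N\<close>; as \<open>N\<close> is null, the
    same bound then holds for \<open>U\<close>.\<close>
  obtain U where U: "open U" "N \<subseteq> U" "(U - N) \<in> lmeasurable" "emeasure lebesgue (U - N) < ennreal \<delta>"
    using sets_lebesgue_outer_open[of N \<delta>] N0 \<open>\<delta> > 0\<close> by blast
  have emU: "emeasure lebesgue U < ennreal \<delta>"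
    using U N0 emeasure_Diff_null_set[of N lebesgue U] by auto
  have Ul: "U \<in> lmeasurable"
    using U(1) emU by (intro fmeasurableI) (auto intro: less_trans ennreal_less_top)
  have mU: "measure lebesgue U < \<delta>"
    using emU Ul \<open>\<delta> > 0\<close> by (simp add: emeasure_eq_measure2 ennreal_less_iff)
  define A where "A t = {\<Sum>i<n. \<bar>f (v i) - f (u i)\<bar> |n u v. ac_family U c t n u v}" for t
  define V where "V t = Sup (A t)" for t
  have A_less: "y < e" if y_in: "y \<in> A t" and "t \<le> d" for y t
  proof -
    obtain n u v where y: "y = (\<Sum>i<n. \<bar>f (v i) - f (u i)\<bar>)" and fam: "ac_family U c t n u v"
      using y_in unfolding A_def by blast
    show ?thesis unfolding y
      using fam that(2) ac_family_length_le[OF fam Ul] mU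
      by (intro \<delta>) (auto simp: ac_family_def)
  qed
  have A_0: "0 \<in> A t" for t
    unfolding A_def by (auto simp: ac_family_def disjoint_family_on_def intro!: exI[of _ 0])
  have bdd: "bdd_above (A t)" if "t \<le> d" for t
    using A_less[OF _ that] by (intro bdd_aboveI[of _ e]) (auto intro: less_imp_le)
  have V_nonneg: "0 \<le> V t" if "t \<le> d" for t
    unfolding V_def using cSup_upper[OF A_0 bdd[OF that]] .
  have V_le: "V t \<le> e" if "t \<le> d" for t
    unfolding V_def using A_0 A_less[OF _ that] by (intro cSup_least) (auto intro: less_imp_le)
  have V_mono: "V s \<le> V t" if "s \<le> t" "t \<le> d" for s t
  proof -
    have "A s \<subseteq> A t" unfolding A_def ac_family_def using that by (blast intro: order_trans)
    then show ?thesis unfolding V_def using A_0[of s] bdd[OF that(2)] by (intro cSup_subset_mono) auto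
  qed
  have V_jump: "V t + \<bar>f s - f t\<bar> \<le> V s" if "c \<le> t" "t \<le> s" "s \<le> d" "{t<..<s} \<subseteq> U" for s t
  proof -
    have "V t \<le> V s - \<bar>f s - f t\<bar>"
      unfolding V_def[of t]
    proof (rule cSup_least)
      show "A t \<noteq> {}" using A_0 by blast
      fix y assume "y \<in> A t"
      then obtain n u v where y: "y = (\<Sum>i<n. \<bar>f (v i) - f (u i)\<bar>)" and fam: "ac_family U c t n u v"
        unfolding A_def by blast
      have "(\<Sum>i<Suc n. \<bar>f ((v(n := s)) i) - f ((u(n := t)) i)\<bar>) \<in> A s"
        unfolding A_def using ac_family_snoc[OF fam that(1,2,4)] by blast
      moreover have "(\<Sum>i<n. \<bar>f ((v(n := s)) i) - f ((u(n := t)) i)\<bar>) = y"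
        unfolding y by (intro sum.cong) auto
      ultimately have "y + \<bar>f s - f t\<bar> \<in> A s" by simp
      then show "y \<le> V s - \<bar>f s - f t\<bar>"
        unfolding V_def using cSup_upper[OF _ bdd[OF that(3)]] by (simp add: le_diff_eq)
    qed
    then show ?thesis by simp
  qed
  define G where "G t = f t + e * (t - c) + V t" for t
  define S where "S = {t \<in> {c..d}. G c \<le> G t}"
  have "c \<in> S" using \<open>c \<le> d\<close> by (simp add: S_def)
  have bddS: "bdd_above S" by (auto simp: S_def intro!: bdd_aboveI[of _ d])
  define t where "t = Sup S"
  have t: "c \<le> t" "t \<le> d"
    unfolding t_def using \<open>c \<in> S\<close> bddS by (auto intro: cSup_upper intro!: cSup_least simp: S_def)
  \<comment> \<open>\<open>V\<close> is only known to be monotone, so \<open>S\<close> is not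
    evidently closed. At its supremum \<open>f\<close> is continuous and the two other summands of
    \<open>G\<close> are nondecreasing, so the limit from the left cannot lose the
    inequality.\<close>
  have "G c \<le> G t"
  proof (rule field_le_epsilon)
    fix r :: real assume "r > 0"
    have "\<exists>\<eta>>0. \<forall>y\<in>{c..d}. dist y t < \<eta> \<longrightarrow> dist (f y) (f t) < r"
      using abs_cont_Icc_continuous_on[OF ac] t \<open>r > 0\<close> unfolding continuous_on_iff by auto
    then obtain \<eta> where "\<eta> > 0" and \<eta>: "\<And>y. y \<in> {c..d} \<Longrightarrow> dist y t < \<eta> \<Longrightarrow> dist (f y) (f t) < r"
      by blast
    obtain s where s: "s \<in> S" "t - \<eta> < s"
      using less_cSupD[of S "t - \<eta>"] \<open>c \<in> S\<close> \<open>\<eta> > 0\<close> unfolding t_def by auto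
    have "s \<le> t" unfolding t_def using s(1) bddS by (rule cSup_upper)
    have "f s < f t + r" using \<eta>[of s] s \<open>s \<le> t\<close> by (auto simp: S_def dist_real_def)
    moreover have "e * (s - c) \<le> e * (t - c)" using \<open>s \<le> t\<close> \<open>e > 0\<close> by simp
    moreover have "V s \<le> V t" using V_mono \<open>s \<le> t\<close> t by blast
    moreover have "G c \<le> G s" using s by (simp add: S_def)
    ultimately show "G c \<le> G t + r" unfolding G_def by linarith
  qed
  have "t = d"
  proof (rule ccontr)
    assume "t \<noteq> d"
    with t have "t < d" by simp
    have "\<exists>s. t < s \<and> s < d \<and> G t \<le> G s"
    proof (cases "t \<in> N")
      case True
      then have "t \<in> U" using U by blast
      then obtain r where "r > 0" "ball t r \<subseteq> U" using \<open>open U\<close> openE by blast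
      define s where "s = min (t + r / 2) ((t + d) / 2)"
      have s: "t < s" "s < d" "s < t + r" using \<open>r > 0\<close> \<open>t < d\<close> by (auto simp: s_def min_def)
      have "{t<..<s} \<subseteq> ball t r" using s by (auto simp: dist_real_def)
      then have "V t + \<bar>f s - f t\<bar> \<le> V s" using s t \<open>ball t r \<subseteq> U\<close> by (intro V_jump) auto
      moreover have "e * (t - c) \<le> e * (s - c)" using s \<open>e > 0\<close> by simp
      ultimately show ?thesis using s unfolding G_def by (intro exI[of _ s]) auto
    next
      case False
      have "\<forall>\<^sub>F s in at_right t. - e * (s - t) \<le> f s - f t"
        using dini t \<open>t < d\<close> False \<open>e > 0\<close> by blast
      moreover have "\<forall>\<^sub>F s in at_right t. t < s \<and> s < d"
        unfolding eventually_at_right[OF \<open>t < d\<close>] using \<open>t < d\<close> by blast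
      ultimately have "\<forall>\<^sub>F s in at_right t. - e * (s - t) \<le> f s - f t \<and> t < s \<and> s < d"
        by eventually_elim simp
      then obtain s where s: "- e * (s - t) \<le> f s - f t" "t < s" "s < d"
        using eventually_happens'[OF trivial_limit_at_right_real] by blast
      moreover have "V t \<le> V s" using s by (intro V_mono) auto
      ultimately show ?thesis unfolding G_def by (intro exI[of _ s]) (auto simp: algebra_simps)
    qed
    then obtain s where "t < s" "s < d" "G t \<le> G s" by blast
    then have "s \<in> S" using t \<open>G c \<le> G t\<close> by (simp add: S_def)
    then have "s \<le> t" unfolding t_def using bddS by (rule cSup_upper)
    with \<open>t < s\<close> show False by simp
  qed
  with \<open>G c \<le> G t\<close> have "G c \<le> G d" by simp
  then show "f c \<le> f d + e0"
    using V_nonneg[OF \<open>c \<le> d\<close>] V_le[of d] e0 unfolding G_def by simp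
qed

section \<open>Monotonicity and increments from one-sided derivatives\<close>

lemma has_real_derivative_right_lower_bound:
  assumes "(f has_real_derivative y) (at t within {t..})" "0 \<le> y" "0 < e"
  shows "\<forall>\<^sub>F s in at_right t. - e * (s - t) \<le> f s - f t"
proof -
  have "((\<lambda>s. (f s - f t) / (s - t)) \<longlongrightarrow> y) (at_right t)"
    using assms(1) unfolding has_field_derivative_iff
    by (rule tendsto_within_subset) auto
  then have "\<forall>\<^sub>F s in at_right t. - e < (f s - f t) / (s - t)"
    using assms by (intro order_tendstoD) auto
  moreover have "\<forall>\<^sub>F s in at_right t. t < s"
    by (simp add: eventually_at_right_less)
  ultimately show ?thesis
    by eventually_elim (auto simp: pos_less_divide_eq)
qed

text \<open>Right derivatives suffice because the continuation argument only moves to the right.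
  They are what is available for primitives of a measurable coefficient, which are differentiated
  below through averages over intervals to the right of a point.\<close>

corollary abs_cont_Icc_le_deriv:
  fixes f :: "real \<Rightarrow> real"
  assumes "c \<le> d" "abs_cont_Icc c d f" "negligible N"
    and "\<And>t. c \<le> t \<Longrightarrow> t < d \<Longrightarrow> t \<notin> N \<Longrightarrow>
      \<exists>y\<ge>0. (f has_real_derivative y) (at t within {t..})"
  shows "f c \<le> f d"
  using assms has_real_derivative_right_lower_bound by (intro abs_cont_Icc_le[OF assms(1-3)]) blast

text \<open>Both \<open>K * t + f t\<close> and \<open>K * t - f t\<close> have a nonnegative right
  derivative off \<open>N\<close>.\<close>

lemma abs_cont_Icc_diff_le:
  fixes f :: "real \<Rightarrow> real"
  assumes "c \<le> d" "abs_cont_Icc c d f" "negligible N"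
    and deriv: "\<And>t. c \<le> t \<Longrightarrow> t < d \<Longrightarrow> t \<notin> N \<Longrightarrow>
      \<exists>y. \<bar>y\<bar> \<le> K \<and> (f has_real_derivative y) (at t within {t..})"
  shows "\<bar>f d - f c\<bar> \<le> K * (d - c)"
proof -
  have ac: "abs_cont_Icc c d (\<lambda>t. K * t)"
    by (rule lipschitz_imp_abs_cont_Icc[of "\<bar>K\<bar>"])
      (auto simp: lipschitz_on_def dist_real_def abs_mult right_diff_distrib[symmetric])
  have "K * c + f c \<le> K * d + f d"
  proof (rule abs_cont_Icc_le_deriv[OF assms(1) _ assms(3)])
    show "abs_cont_Icc c d (\<lambda>t. K * t + f t)"
      using ac assms(2) by (rule abs_cont_Icc_add)
    fix t assume "c \<le> t" "t < d" "t \<notin> N"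
    then obtain y where "\<bar>y\<bar> \<le> K" "(f has_real_derivative y) (at t within {t..})"
      using deriv by blast
    then show "\<exists>y\<ge>0. ((\<lambda>t. K * t + f t) has_real_derivative y) (at t within {t..})"
      by (intro exI[of _ "K + y"] conjI) (auto intro!: derivative_eq_intros)
  qed
  moreover have "K * c + - f c \<le> K * d + - f d"
  proof (rule abs_cont_Icc_le_deriv[OF assms(1) _ assms(3)])
    show "abs_cont_Icc c d (\<lambda>t. K * t + - f t)"
      using ac abs_cont_Icc_minus[OF assms(2)] by (rule abs_cont_Icc_add)
    fix t assume "c \<le> t" "t < d" "t \<notin> N"
    then obtain y where "\<bar>y\<bar> \<le> K" "(f has_real_derivative y) (at t within {t..})"
      using deriv by blast
    then show "\<exists>y\<ge>0. ((\<lambda>t. K * t + - f t) has_real_derivative y) (at t within {t..})"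
      by (intro exI[of _ "K - y"] conjI) (auto intro!: derivative_eq_intros)
  qed
  ultimately show ?thesis by (simp add: abs_le_iff algebra_simps)
qed

section \<open>Positivity and comparison for averaged delays\<close>

text \<open>This is Lebesgue differentiation in the form of averages over intervals starting at
  \<open>r\<close>, hence the one-sided derivative. Extension by 0 makes the integrand global, and
  close to a point \<open>r < T\<close> the averages do not see the extension.\<close>

lemma integral_has_right_derivative_AE:
  fixes c :: "real \<Rightarrow> real"
  assumes c: "c integrable_on {\<sigma>..T}"
  obtains N where "negligible N"
    and "\<And>r. \<sigma> \<le> r \<Longrightarrow> r < T \<Longrightarrow> r \<notin> N \<Longrightarrow>
      ((\<lambda>r. integral {\<sigma>..r} c) has_real_derivative c r) (at r within {r..})"
proof -
  define f where "f r = (if r \<in> {\<sigma>..T} then c r else 0)" for r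
  have "f integrable_on UNIV"
    using c unfolding f_def integrable_restrict_UNIV .
  then have "f integrable_on cbox a b" for a b
    using integrable_on_subcbox by blast
  then obtain N where N: "negligible N"
    and lim: "\<And>r e. r \<notin> N \<Longrightarrow> 0 < e \<Longrightarrow>
      \<exists>d>0. \<forall>h. 0 < h \<and> h < d \<longrightarrow> norm (integral (cbox r (r + h *\<^sub>R One)) f /\<^sub>R h ^ DIM(real) - f r) < e"
    using integrable_ccontinuous_explicit[of f] by blast
  show thesis
  proof (rule that[OF N])
    fix r assume r: "\<sigma> \<le> r" "r < T" "r \<notin> N"
    have "((\<lambda>s. (integral {\<sigma>..s} c - integral {\<sigma>..r} c) / (s - r)) \<longlongrightarrow> c r) (at_right r)"
    proof (rule tendstoI)
      fix e :: real assume "e > 0"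
      then obtain d where "d > 0"
        and d: "\<And>h. 0 < h \<Longrightarrow> h < d \<Longrightarrow> norm (integral {r..r + h} f / h - f r) < e"
        using lim[OF r(3) \<open>e > 0\<close>] by (auto simp: divide_inverse mult.commute)
      have "dist ((integral {\<sigma>..s} c - integral {\<sigma>..r} c) / (s - r)) (c r) < e"
        if "r < s" "s < min T (r + d)" for s
      proof -
        have "integral {\<sigma>..r} c + integral {r..s} c = integral {\<sigma>..s} c"
          using r that by (intro Henstock_Kurzweil_Integration.integral_combine
              integrable_on_subinterval[OF c]) auto
        moreover have "integral {r..s} c = integral {r..s} f"
          using r that by (intro integral_cong) (auto simp: f_def)
        moreover have "f r = c r" using r by (simp add: f_def)
        ultimately have "integral {\<sigma>..s} c - integral {\<sigma>..r} c = integral {r..s} f" "f r = c r"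
          by linarith+
        then show ?thesis
          using d[of "s - r"] that by (auto simp: dist_real_def)
      qed
      moreover have "r < min T (r + d)" using r \<open>d > 0\<close> by simp
      ultimately show "\<forall>\<^sub>F s in at_right r.
          dist ((integral {\<sigma>..s} c - integral {\<sigma>..r} c) / (s - r)) (c r) < e"
        unfolding eventually_at_right[OF \<open>r < min T (r + d)\<close>] by blast
    qed
    then have "((\<lambda>s. (integral {\<sigma>..s} c - integral {\<sigma>..r} c) / (s - r)) \<longlongrightarrow> c r) (at r within {r..})"
      by (simp add: at_within_Ici_at_right)
    then show "((\<lambda>r. integral {\<sigma>..r} c) has_real_derivative c r) (at r within {r..})"
      unfolding has_field_derivative_iff .
  qed
qed

text \<open>
  With \<open>C\<close> a primitive of \<open>c\<close>, let \<open>w = u exp (e C)\<close> attain its maximum \<open>W\<close> over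
  \<open>[\<sigma>, t]\<close> at \<open>s\<close>. As \<open>C r - C q \<le> 1 / e\<close> for \<open>q \<ge> H r\<close>, the averages of \<open>u\<close> at \<open>r \<in> [s, t]\<close>
  are at most \<open>e W exp (- e C r)\<close>, so \<open>u - W exp (- e C)\<close>, which vanishes at \<open>s\<close>, is nondecreasing
  on \<open>[s, t]\<close>. Hence the maximum is also attained at \<open>t\<close>.
\<close>

lemma delay_positivity:
  fixes u c H :: "real \<Rightarrow> real"
  assumes u: "abs_cont_Icc \<sigma> T u" and u0: "0 \<le> u \<sigma>"
    and c: "c integrable_on {\<sigma>..T}" "\<And>r. \<sigma> \<le> r \<Longrightarrow> r \<le> T \<Longrightarrow> 0 \<le> c r \<and> c r \<le> c1"
    and H: "\<And>r. \<sigma> \<le> r \<Longrightarrow> r \<le> T \<Longrightarrow> H r \<le> r \<and> integral {max \<sigma> (H r)..r} c \<le> 1 / exp 1"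
    and N: "negligible N"
    and ineq: "\<And>r. \<sigma> \<le> r \<Longrightarrow> r < T \<Longrightarrow> r \<notin> N \<Longrightarrow>
      \<exists>y l. (u has_real_derivative y) (at r within {r..}) \<and> 0 \<le> y + c r * l \<and>
        (\<forall>m. (\<forall>q\<in>{max \<sigma> (H r)..r}. u q \<le> m) \<longrightarrow> l \<le> m)"
    and t: "\<sigma> \<le> t" "t \<le> T"
  shows "0 \<le> u t"
proof -
  define C where "C r = integral {\<sigma>..r} c" for r
  obtain N' where N': "negligible N'"
    and C_deriv: "\<And>r. \<sigma> \<le> r \<Longrightarrow> r < T \<Longrightarrow> r \<notin> N' \<Longrightarrow> (C has_real_derivative c r) (at r within {r..})"
    using integral_has_right_derivative_AE[OF c(1)] unfolding C_def by blast
  have C_diff: "C r - C q = integral {q..r} c" if "\<sigma> \<le> q" "q \<le> r" "r \<le> T" for q r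
    using Henstock_Kurzweil_Integration.integral_combine[of \<sigma> q r c]
      integrable_on_subinterval[OF c(1), of \<sigma> r] that unfolding C_def by auto
  have C_mono: "C q \<le> C r" if "\<sigma> \<le> q" "q \<le> r" "r \<le> T" for q r
  proof -
    have "0 \<le> integral {q..r} c"
      using that c(2) by (intro integral_nonneg integrable_on_subinterval[OF c(1)]) auto
    with C_diff[OF that] show ?thesis by simp
  qed
  have C_0: "C \<sigma> = 0" by (simp add: C_def)
  have C_nonneg: "0 \<le> C r" if "\<sigma> \<le> r" "r \<le> T" for r
    using C_mono[of \<sigma> r] that C_0 by simp
  have C_upper: "C r - C q \<le> c1 * (r - q)" if "\<sigma> \<le> q" "q \<le> r" "r \<le> T" for q r
  proof -
    have "integral {q..r} c \<le> integral {q..r} (\<lambda>_. c1)"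
      using that c(2) by (intro integral_le integrable_on_subinterval[OF c(1)]) auto
    then show ?thesis using that C_diff[OF that] by (simp add: mult.commute)
  qed
  have "c1 \<ge> 0" using c(2)[of \<sigma>] t by force
  have C_lip: "c1-lipschitz_on {\<sigma>..T} C"
  proof (rule lipschitz_onI)
    fix x y assume "x \<in> {\<sigma>..T}" "y \<in> {\<sigma>..T}"
    then show "dist (C x) (C y) \<le> c1 * dist x y"
      using C_upper[of x y] C_upper[of y x] C_mono[of x y] C_mono[of y x]
      by (cases "x \<le> y") (auto simp: dist_real_def)
  qed fact
  \<comment> \<open>The rate e is forced: an exponential of \<open>C\<close> decaying with rate
    \<lambda> is compatible with windows over which \<open>c\<close> integrates to 1 / e only if exp
    (\<lambda> / e) \<le> \<lambda>, and \<lambda> = e is the sole solution, with equality.\<close>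
  define E where "E r = exp (- exp 1 * C r)" for r
  \<comment> \<open>\<open>C\<close> is nonnegative, so only arguments in \<open>{..0}\<close>
    occur, where the exponential is 1-Lipschitz. This makes \<open>E\<close> Lipschitz and hence
    absolutely continuous.\<close>
  have "1-lipschitz_on {..0} (exp :: real \<Rightarrow> real)"
  proof (rule lipschitz_onI)
    have le: "exp y - exp x \<le> y - x" if "x \<le> y" "y \<le> 0" for x y :: real
    proof -
      have "exp y * (1 + (x - y)) \<le> exp y * exp (x - y)"
        using exp_ge_add_one_self[of "x - y"] by (intro mult_left_mono) auto
      then have "exp y - exp x \<le> exp y * (y - x)" by (simp add: exp_diff algebra_simps)
      also have "\<dots> \<le> 1 * (y - x)" using that by (intro mult_right_mono) auto
      finally show ?thesis by simp
    qed
    fix x y :: real assume "x \<in> {..0}" "y \<in> {..0}"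
    then show "dist (exp x) (exp y) \<le> 1 * dist x y"
      using le[of x y] le[of y x] by (cases "x \<le> y") (auto simp: dist_real_def abs_le_iff)
  qed simp
  then have "1-lipschitz_on ((\<lambda>r. - exp 1 * C r) ` {\<sigma>..T}) exp"
    by (rule lipschitz_on_subset) (use C_nonneg in auto)
  from lipschitz_on_compose2[OF lipschitz_on_cmult_real[OF C_lip] this]
  have "(1 * (\<bar>- exp 1\<bar> * c1))-lipschitz_on {\<sigma>..T} E"
    unfolding E_def .
  then have E_ac: "\<exists>K. K-lipschitz_on {\<sigma>..T} E" by blast
  have E_pos: "E r > 0" for r by (simp add: E_def)
  have contE: "continuous_on {\<sigma>..t} E"
    using E_ac t by (auto intro: continuous_on_subset lipschitz_on_continuous_on)
  define w where "w r = u r / E r" for r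
  have "continuous_on {\<sigma>..t} w"
    unfolding w_def using E_pos t
    by (intro continuous_intros contE continuous_on_subset[OF abs_cont_Icc_continuous_on[OF u]])
      (auto simp: less_imp_neq[THEN not_sym])
  then obtain s where s: "s \<in> {\<sigma>..t}" and s_max: "\<And>r. r \<in> {\<sigma>..t} \<Longrightarrow> w r \<le> w s"
    using continuous_attains_sup[of "{\<sigma>..t}" w] t by auto
  define W where "W = w s"
  have "0 \<le> w \<sigma>" using u0 by (simp add: w_def E_def)
  also have "\<dots> \<le> W" unfolding W_def using s_max t by simp
  finally have "0 \<le> W" .
  have u_le: "u r \<le> W * E r" if "r \<in> {\<sigma>..t}" for r
    using s_max[OF that] E_pos[of r] unfolding W_def w_def[of r] by (simp add: pos_divide_le_eq)
  define G where "G r = u r + - (W * E r)" for r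
  have "G s \<le> G t"
  proof (rule abs_cont_Icc_le_deriv[where f = G])
    obtain K where "K-lipschitz_on {\<sigma>..T} E" using E_ac by blast
    then have "(\<bar>W\<bar> * K)-lipschitz_on {\<sigma>..T} (\<lambda>r. W * E r)"
      by (rule lipschitz_on_cmult_real)
    then have "abs_cont_Icc \<sigma> T G"
      unfolding G_def[abs_def] by (rule abs_cont_Icc_add[OF u abs_cont_Icc_minus[OF lipschitz_imp_abs_cont_Icc]])
    then show "abs_cont_Icc s t G" by (rule abs_cont_Icc_subset) (use s t in auto)
    show "negligible (N \<union> N')" using N N' by simp
    fix r assume r: "s \<le> r" "r < t" "r \<notin> N \<union> N'"
    then have rT: "\<sigma> \<le> r" "r < T" "r \<notin> N" "r \<notin> N'" using s t by auto
    \<comment> \<open>\<open>l\<close> stands for the average of \<open>u\<close>; it is known only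
      through lying below every upper bound of \<open>u\<close> on the window cut at
      \<sigma>.\<close>
    obtain y l where yl: "(u has_real_derivative y) (at r within {r..})" "0 \<le> y + c r * l"
      "\<And>m. (\<forall>q\<in>{max \<sigma> (H r)..r}. u q \<le> m) \<Longrightarrow> l \<le> m"
      using ineq[OF rT(1-3)] by blast
    have "l \<le> exp 1 * W * E r"
    proof (rule yl(3), intro ballI)
      fix q assume q: "q \<in> {max \<sigma> (H r)..r}"
      have "integral {q..r} c \<le> integral {max \<sigma> (H r)..r} c"
        using q rT c(2) by (intro integral_subset_le integrable_on_subinterval[OF c(1)]) auto
      then have "C r - C q \<le> 1 / exp 1"
        using C_diff[of q r] H[of r] q rT by auto
      then have "- exp 1 * C q \<le> 1 - exp 1 * C r" by (simp add: field_simps)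
      then have "E q \<le> exp 1 * E r" unfolding E_def by (simp flip: exp_add)
      then have "W * E q \<le> W * (exp 1 * E r)" using \<open>0 \<le> W\<close> by (intro mult_left_mono)
      then show "u q \<le> exp 1 * W * E r" using u_le[of q] q r by (simp add: mult_ac)
    qed
    then have "c r * l \<le> c r * (exp 1 * W * E r)" using c(2)[of r] rT by (intro mult_left_mono) auto
    then have "0 \<le> y + c r * (exp 1 * W * E r)" using yl(2) by linarith
    moreover have "(G has_real_derivative y + c r * (exp 1 * W * E r)) (at r within {r..})"
      unfolding G_def E_def
      by (rule derivative_eq_intros yl(1) C_deriv[OF rT(1,2,4)] refl)+ (simp add: algebra_simps)
    ultimately show "\<exists>y\<ge>0. (G has_real_derivative y) (at r within {r..})" by blast
  qed (use s in auto)
  moreover have "G s = 0" using E_pos[of s] by (simp add: G_def W_def w_def)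
  ultimately have "W * E t \<le> u t" unfolding G_def by simp
  moreover have "0 \<le> W * E t" using \<open>0 \<le> W\<close> E_pos[of t] by simp
  ultimately show ?thesis by linarith
qed

text \<open>Both k + x and k - x are nonnegative by \<open>delay_positivity\<close>, where k is the
  claimed bound, continued by the constant \<open>K\<close> before \<sigma>. As k is nonincreasing,
  its average L k over the past is at least k, so k' + c L k \<ge> (c - \<gamma>) k \<ge> c (1 -
  \<gamma> / \<kappa>) k because c \<ge> \<kappa>. This is exactly the forcing that the hypothesis
  allows.\<close>

lemma delay_exponential_comparison:
  fixes x c H :: "real \<Rightarrow> real" and M :: "real \<Rightarrow> real measure"
  assumes x: "abs_cont_Icc \<sigma> T x" "x \<in> borel_measurable borel" "bounded (x ` {..T})"
    and const: "\<And>s. s \<le> \<sigma> \<Longrightarrow> x s = x \<sigma>" and x0: "\<bar>x \<sigma>\<bar> \<le> K"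
    and \<gamma>: "0 < \<gamma>" "\<gamma> < \<kappa>"
    and c: "c integrable_on {\<sigma>..T}" "\<And>r. \<sigma> \<le> r \<Longrightarrow> r \<le> T \<Longrightarrow> \<kappa> \<le> c r \<and> c r \<le> c1"
    and H: "\<And>r. \<sigma> \<le> r \<Longrightarrow> r \<le> T \<Longrightarrow> H r \<le> r \<and> integral {max \<sigma> (H r)..r} c \<le> 1 / exp 1"
    and N: "negligible N"
    and M: "\<And>r. \<sigma> \<le> r \<Longrightarrow> r < T \<Longrightarrow> r \<notin> N \<Longrightarrow>
      prob_space (M r) \<and> sets (M r) = sets borel \<and> (AE s in M r. H r \<le> s \<and> s \<le> r)"
    and ineq: "\<And>r. \<sigma> \<le> r \<Longrightarrow> r < T \<Longrightarrow> r \<notin> N \<Longrightarrow>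
      \<exists>y. (x has_real_derivative y) (at r within {r..}) \<and>
        \<bar>y + c r * (LINT s|M r. x s)\<bar> \<le> c r * (1 - \<gamma> / \<kappa>) * K * exp (- \<gamma> * (r - \<sigma>))"
    and t: "\<sigma> \<le> t" "t \<le> T"
  shows "\<bar>x t\<bar> \<le> K * exp (- \<gamma> * (t - \<sigma>))"
proof -
  define k where "k s = K * exp (- \<gamma> * (max s \<sigma> - \<sigma>))" for s
  have "0 \<le> K" using x0 by linarith
  have k_antimono: "k r \<le> k s" if "s \<le> r" for r s
    using that \<gamma> \<open>0 \<le> K\<close> unfolding k_def by (intro mult_left_mono) (auto simp: max_def)
  have k_bound: "\<bar>k s\<bar> \<le> K" for s
    using \<gamma> \<open>0 \<le> K\<close> unfolding k_def by (auto simp: abs_mult intro!: mult_left_le)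
  have k_meas: "k \<in> borel_measurable borel" unfolding k_def by measurable
  have k_deriv: "(k has_real_derivative - \<gamma> * k r) (at r within {r..})" if "\<sigma> \<le> r" for r
  proof (rule has_field_derivative_transform_within[of "\<lambda>s. K * exp (- \<gamma> * (s - \<sigma>))" _ _ _ 1])
    show "((\<lambda>s. K * exp (- \<gamma> * (s - \<sigma>))) has_real_derivative - \<gamma> * k r) (at r within {r..})"
      using that by (auto intro!: derivative_eq_intros simp: k_def)
  qed (use that in \<open>auto simp: k_def\<close>)
  have k_ac: "abs_cont_Icc \<sigma> T k"
  proof (rule lipschitz_imp_abs_cont_Icc)
    show "(\<gamma> * K)-lipschitz_on {\<sigma>..T} k"
    proof (rule lipschitz_onI)
      have le: "k s - k r \<le> \<gamma> * K * (r - s)" if "\<sigma> \<le> s" "s \<le> r" for s r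
      proof -
        have "k s * (1 + - \<gamma> * (r - s)) \<le> k s * exp (- \<gamma> * (r - s))"
          using exp_ge_add_one_self[of "- \<gamma> * (r - s)"] \<open>0 \<le> K\<close>
          by (intro mult_left_mono) (auto simp: k_def)
        also have "\<dots> = K * exp (- \<gamma> * (s - \<sigma>) + - \<gamma> * (r - s))"
          using that by (simp only: k_def exp_add) simp
        also have "\<dots> = k r" using that by (simp add: k_def algebra_simps)
        finally have "k s - k r \<le> k s * (\<gamma> * (r - s))" by (simp add: algebra_simps)
        also have "\<dots> \<le> K * (\<gamma> * (r - s))"
          using k_bound[of s] that \<gamma> by (intro mult_right_mono) auto
        finally show ?thesis by (simp add: mult_ac)
      qed
      fix s r assume "s \<in> {\<sigma>..T}" "r \<in> {\<sigma>..T}"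
      then show "dist (k s) (k r) \<le> \<gamma> * K * dist s r"
        using le[of s r] le[of r s] k_antimono[of s r] k_antimono[of r s]
        by (cases "s \<le> r") (auto simp: dist_real_def)
    qed (use \<gamma> \<open>0 \<le> K\<close> in auto)
  qed
  have pos: "0 \<le> k t + z * x t" if z: "z = 1 \<or> z = -1" for z
  proof (rule delay_positivity[where u = "\<lambda>s. k s + z * x s" and c = c and H = H])
    show "abs_cont_Icc \<sigma> T (\<lambda>s. k s + z * x s)"
      using z abs_cont_Icc_add[OF k_ac x(1)] abs_cont_Icc_add[OF k_ac abs_cont_Icc_minus[OF x(1)]]
      by auto
    show "0 \<le> k \<sigma> + z * x \<sigma>" using x0 z by (auto simp: k_def abs_le_iff)
    show "0 \<le> c r \<and> c r \<le> c1" if "\<sigma> \<le> r" "r \<le> T" for r using c(2)[OF that] \<gamma> by linarith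
    fix r assume r: "\<sigma> \<le> r" "r < T" "r \<notin> N"
    interpret prob_space "M r" using M[OF r] by blast
    have sets[measurable_cong]: "sets (M r) = sets borel" and AE: "AE s in M r. H r \<le> s \<and> s \<le> r"
      using M[OF r] by auto
    obtain y where y: "(x has_real_derivative y) (at r within {r..})"
      "\<bar>y + c r * (LINT s|M r. x s)\<bar> \<le> c r * (1 - \<gamma> / \<kappa>) * k r"
      using ineq[OF r] r(1) by (auto simp: k_def max_def mult.assoc)
    obtain D where D: "\<And>s. s \<le> T \<Longrightarrow> \<bar>x s\<bar> \<le> D" using x(3) by (auto simp: bounded_iff)
    have x_int: "integrable (M r) x"
    proof (rule integrable_const_bound[of _ D])
      show "AE s in M r. norm (x s) \<le> D"
        using AE by eventually_elim (use D r in auto)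
    qed (use x(2) in measurable)
    have k_int: "integrable (M r) k"
      using k_bound k_meas by (intro integrable_const_bound[of _ K]) auto
    define l where "l = (LINT s|M r. k s + z * x s)"
    have l: "l = (LINT s|M r. k s) + z * (LINT s|M r. x s)"
      unfolding l_def using x_int k_int by simp
    have "k r \<le> (LINT s|M r. k s)"
      by (rule integral_ge_const[OF k_int], rule eventually_mono[OF AE]) (simp add: k_antimono)
    moreover have "c r \<ge> 0" using c(2)[of r] r \<gamma> by auto
    ultimately have "c r * k r \<le> c r * (LINT s|M r. k s)" by (intro mult_left_mono)
    moreover have "- (c r * (1 - \<gamma> / \<kappa>) * k r) \<le> z * (y + c r * (LINT s|M r. x s))"
      using y(2) z by (auto simp: abs_le_iff)
    moreover have "\<gamma> * k r \<le> c r * (\<gamma> / \<kappa>) * k r"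
    proof (rule mult_right_mono)
      have "\<kappa> * (\<gamma> / \<kappa>) \<le> c r * (\<gamma> / \<kappa>)" using c(2)[of r] r \<gamma> by (intro mult_right_mono) auto
      then show "\<gamma> \<le> c r * (\<gamma> / \<kappa>)" using \<gamma> by simp
    qed (use \<open>0 \<le> K\<close> in \<open>simp add: k_def\<close>)
    ultimately have "0 \<le> - \<gamma> * k r + z * y + c r * l"
      unfolding l by (simp add: algebra_simps)
    moreover have "((\<lambda>s. k s + z * x s) has_real_derivative - \<gamma> * k r + z * y) (at r within {r..})"
      using k_deriv[OF r(1)] y(1) by (auto intro!: derivative_eq_intros)
    \<comment> \<open>The measure may charge times before \<sigma>, whereas \<open>m\<close> is a
      bound only on the window cut at \<sigma>. Since \<open>k\<close> and \<open>x\<close> are both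
      constant up to \<sigma>, values at earlier times can be read off at \<sigma>.\<close>
    moreover have "l \<le> m" if m: "\<forall>q\<in>{max \<sigma> (H r)..r}. k q + z * x q \<le> m" for m
      unfolding l_def
    proof (rule integral_le_const)
      show "AE s in M r. k s + z * x s \<le> m"
        using AE
      proof eventually_elim
        fix s assume s: "H r \<le> s \<and> s \<le> r"
        have "k s + z * x s = k (max \<sigma> s) + z * x (max \<sigma> s)"
          using const[of s] by (auto simp: k_def max_def)
        then show "k s + z * x s \<le> m" using m s r by auto
      qed
    qed (use x_int k_int in simp)
    ultimately show "\<exists>y l. ((\<lambda>s. k s + z * x s) has_real_derivative y) (at r within {r..}) \<and> 0 \<le> y + c r * l \<and>
        (\<forall>m. (\<forall>q\<in>{max \<sigma> (H r)..r}. k q + z * x q \<le> m) \<longrightarrow> l \<le> m)"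
      by (intro exI[of _ "- \<gamma> * k r + z * y"] exI[of _ l]) simp
  qed (use c(1) H N t in auto)
  show ?thesis using pos[of 1] pos[of "-1"] t by (simp add: k_def max_def abs_le_iff)
qed

section \<open>A priori estimate for solutions\<close>

text \<open>Explicit exceptional sets can be united and pulled back along \<open>g\<close>, which
  almost-everywhere quantifiers do not allow directly. Completeness of Lebesgue measure makes the
  set of failures itself null.\<close>

lemma AE_lebesgue_on_negligible:
  assumes "S \<in> sets lebesgue"
  shows "(AE t in lebesgue_on S. P t) \<longleftrightarrow> (\<exists>N. negligible N \<and> (\<forall>t\<in>S - N. P t))"
proof -
  have "(AE t in lebesgue_on S. P t) \<longleftrightarrow> (AE t in lebesgue. t \<in> S \<longrightarrow> P t)"
    using assms by (simp add: AE_restrict_space_iff)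
  also have "\<dots> \<longleftrightarrow> (\<exists>N. negligible N \<and> (\<forall>t\<in>S - N. P t))"
    unfolding eventually_ae_filter negligible_iff_null_sets
    by (auto; meson completion.complete2 null_sets_completion_subset subsetI mem_Collect_eq DiffI)
  finally show ?thesis .
qed

text \<open>The total mass is the increment of the kernel from \<open>c\<close> to the right limit
  at \<open>t\<close>, that is 1 - 0, so the delayed term of the equation is an average of past
  values.\<close>

lemma prob_space_stieltjes_Icc:
  assumes "0 \<le> t" "c \<le> t" and mono: "mono_on ({0..} \<union> {c}) (zero_ext F)"
    and c: "zero_ext F c = 0" and lim: "(F \<longlongrightarrow> 1) (at_right t)"
  shows "prob_space (stieltjes_Icc (zero_ext F) c t)"
    and "sets (stieltjes_Icc (zero_ext F) c t) = sets borel"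
    and "AE s in stieltjes_Icc (zero_ext F) c t. c \<le> s \<and> s \<le> t"
proof -
  let ?M = "stieltjes_Icc (zero_ext F) c t"
  show sets: "sets ?M = sets borel" by (simp add: stieltjes_Icc_def)
  \<comment> \<open>For \<open>c < 0\<close> the extension vanishes between \<open>c\<close> and 0,
    and its value 0 at \<open>c\<close> bounds it from below on \<open>{0..}\<close>. This fills the
    gap in the domain on which monotonicity is assumed.\<close>
  have mono': "mono_on {c..} (zero_ext F)"
  proof (rule mono_onI)
    fix r s assume rs: "r \<in> {c..}" "s \<in> {c..}" "r \<le> s"
    have "0 \<le> zero_ext F s" if "0 \<le> s"
      using mono_onD[OF mono, of c s] c that rs by auto
    moreover have "zero_ext F r \<le> zero_ext F s" if "0 \<le> r"
      using mono_onD[OF mono, of r s] that rs by auto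
    ultimately show "zero_ext F r \<le> zero_ext F s"
      by (cases "0 \<le> r") (auto simp: zero_ext_def)
  qed
  have "(zero_ext F \<longlongrightarrow> 1) (at_right t)"
  proof (rule Lim_transform_eventually[OF lim])
    show "\<forall>\<^sub>F s in at_right t. F s = zero_ext F s"
      using \<open>0 \<le> t\<close> eventually_at_right_less[of t] by (auto elim!: eventually_mono simp: zero_ext_def)
  qed
  then have "Lim (at_right t) (zero_ext F) = 1" by (intro tendsto_Lim) auto
  with emeasure_stieltjes_Icc[OF \<open>c \<le> t\<close> mono'] c
  have 1: "emeasure ?M {c..t} = 1" and 0: "emeasure ?M (- {c..t}) = 0" by auto
  have space: "space ?M = UNIV" by (simp add: stieltjes_Icc_def)
  have "emeasure ?M UNIV = emeasure ?M {c..t} + emeasure ?M (- {c..t})"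
    by (subst plus_emeasure) (auto simp: sets)
  with 0 1 space show "prob_space ?M" by (intro prob_spaceI) simp
  show "AE s in ?M. c \<le> s \<and> s \<le> t"
    by (rule AE_I[OF _ 0]) (auto simp: sets)
qed

text \<open>Two linear inequalities between the weighted suprema of |x| and |x'| are solved by
  eliminating the second; \<theta> is one minus the gain around this loop, and its positivity is the
  contraction condition relaxed by \<rho>. The bound \<open>D\<close> makes the supremum of |x'|
  finite but does not enter the constant, which is what makes the estimate uniform over
  solutions.\<close>

lemma solution_estimate:
  fixes x a b c g h H \<psi> :: "real \<Rightarrow> real" and M :: "real \<Rightarrow> real measure"
  assumes "\<sigma> \<le> T" and x: "abs_cont_Icc \<sigma> T x" "x \<in> borel_measurable borel"
    and data: "\<And>s. s \<le> \<sigma> \<Longrightarrow> \<bar>x s\<bar> \<le> \<Phi>" "\<And>s. s < \<sigma> \<Longrightarrow> \<bar>\<psi> s\<bar> \<le> \<Phi>"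
    and g: "\<And>t. \<sigma> \<le> t \<Longrightarrow> t \<le> T \<Longrightarrow> g t \<le> t \<and> t - g t \<le> d"
    and h: "\<And>t. \<sigma> \<le> t \<Longrightarrow> t \<le> T \<Longrightarrow> h t \<le> H t \<and> H t \<le> t \<and> t - h t \<le> d"
    and g_null: "\<And>E. negligible E \<Longrightarrow> negligible {t \<in> {\<sigma>..T}. g t \<in> E}"
    and c: "c integrable_on {\<sigma>..T}" "\<And>r. \<sigma> \<le> r \<Longrightarrow> r \<le> T \<Longrightarrow> \<kappa> \<le> c r \<and> c r \<le> c1"
    and H: "\<And>r. \<sigma> \<le> r \<Longrightarrow> r \<le> T \<Longrightarrow> integral {max \<sigma> (H r)..r} c \<le> 1 / exp 1"
    and N: "negligible N"
    and M: "\<And>t. t \<in> {\<sigma>..T} - N \<Longrightarrow>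
      prob_space (M t) \<and> sets (M t) = sets borel \<and> (AE s in M t. h t \<le> s \<and> s \<le> t)"
    and eq: "\<And>t. t \<in> {\<sigma>..T} - N \<Longrightarrow> x differentiable at t \<and> \<bar>deriv x t\<bar> \<le> D \<and>
      deriv_from \<sigma> \<psi> x t - a t * deriv_from \<sigma> \<psi> x (g t) + b t * (LINT s|M t. x s) = 0"
    and coef: "\<And>t. t \<in> {\<sigma>..T} - N \<Longrightarrow> \<bar>a t\<bar> \<le> \<alpha> \<and> \<bar>a t\<bar> \<le> p1 * c t \<and> c t \<le> b t \<and> b t \<le> \<omega> \<and>
      b t - c t \<le> q * c t \<and> H t - h t \<le> p2"
    and nonneg: "0 \<le> \<alpha>" "0 \<le> \<omega>" "0 \<le> p1" "0 \<le> p2" "0 \<le> q" "0 \<le> d"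
    and \<gamma>: "0 < \<gamma>" "\<gamma> < \<kappa>" and \<rho>: "exp (\<gamma> * d) \<le> \<rho> * (1 - \<gamma> / \<kappa>)"
    and \<rho>\<alpha>: "\<rho> * \<alpha> < 1"
    and \<theta>: "\<theta> = 1 - \<rho> * q - \<rho> * (p1 + p2) * (\<rho> * \<omega> / (1 - \<rho> * \<alpha>))" "0 < \<theta>"
    and t: "\<sigma> \<le> t" "t \<le> T"
  shows "\<bar>x t\<bar> \<le> (1 + \<rho> * (p1 + q + 2) + \<rho> * (p1 + p2) * (\<rho> * (\<alpha> + \<omega>) / (1 - \<rho> * \<alpha>))) / \<theta>
    * \<Phi> * exp (- \<gamma> * (t - \<sigma>))"
proof -
  define E where "E t = exp (- \<gamma> * (t - \<sigma>))" for t
  define \<eta> where "\<eta> = exp (\<gamma> * d)"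
  have E_pos: "E t > 0" for t by (simp add: E_def)
  have "0 \<le> \<Phi>" using data(1)[of \<sigma>] by simp
  have E_delay: "E s \<le> \<eta> * E t" if "t - s \<le> d" for s t
  proof -
    have "\<gamma> * (t - s) \<le> \<gamma> * d" using that \<gamma> by (intro mult_left_mono) auto
    then show ?thesis unfolding E_def \<eta>_def by (simp flip: exp_add add: algebra_simps)
  qed
  \<comment> \<open>Initial data carry no decaying weight. They are seen only at times at most
    \<open>d\<close> after \<sigma>, when \<open>\<eta> * E t\<close> is still at least 1, so \<Phi>
    can be charged to the weight.\<close>
  have E_start: "1 \<le> \<eta> * E t" if "t - s \<le> d" "s \<le> \<sigma>" for s t
    using E_delay[of t \<sigma>] that by (simp add: E_def)
  have "1 \<le> \<eta>" unfolding \<eta>_def using nonneg \<gamma> by simp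
  have \<kappa>: "0 < 1 - \<gamma> / \<kappa>" "1 - \<gamma> / \<kappa> \<le> 1" using \<gamma> by auto
  have "0 < \<rho>"
  proof (rule ccontr)
    assume "\<not> 0 < \<rho>"
    then have "\<rho> * (1 - \<gamma> / \<kappa>) \<le> 0" using \<kappa> by (intro mult_nonpos_nonneg) auto
    with \<rho> \<open>1 \<le> \<eta>\<close> show False unfolding \<eta>_def by linarith
  qed
  have "\<rho> * (1 - \<gamma> / \<kappa>) \<le> \<rho> * 1" using \<kappa> \<open>0 < \<rho>\<close> by (intro mult_left_mono) auto
  then have "\<eta> \<le> \<rho>" using \<rho> unfolding \<eta>_def by simp
  have cont: "continuous_on {\<sigma>..T} x" using x(1) by (rule abs_cont_Icc_continuous_on)
  have "continuous_on {\<sigma>..T} (\<lambda>t. \<bar>x t\<bar> / E t)"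
    unfolding E_def by (intro continuous_intros cont) simp
  then obtain t1 where t1: "t1 \<in> {\<sigma>..T}" and t1_max: "\<And>r. r \<in> {\<sigma>..T} \<Longrightarrow> \<bar>x r\<bar> / E r \<le> \<bar>x t1\<bar> / E t1"
    using continuous_attains_sup[of "{\<sigma>..T}" "\<lambda>t. \<bar>x t\<bar> / E t"] \<open>\<sigma> \<le> T\<close> by auto
  define Y where "Y = \<bar>x t1\<bar> / E t1"
  have Y: "\<bar>x r\<bar> \<le> Y * E r" if "r \<in> {\<sigma>..T}" for r
    using t1_max[OF that] E_pos[of r] unfolding Y_def by (simp add: pos_divide_le_eq)
  have "0 \<le> Y" unfolding Y_def using E_pos[of t1] by simp
  have x_le: "\<bar>x s\<bar> \<le> \<eta> * (Y + \<Phi>) * E t" if "t \<in> {\<sigma>..T}" "s \<le> t" "t - s \<le> d" for s t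
  proof (cases "s \<le> \<sigma>")
    case True
    have "\<bar>x s\<bar> \<le> (Y + \<Phi>) * 1" using data(1)[OF True] \<open>0 \<le> Y\<close> by simp
    also have "\<dots> \<le> (Y + \<Phi>) * (\<eta> * E t)"
      using E_start[OF that(3) True] \<open>0 \<le> Y\<close> \<open>0 \<le> \<Phi>\<close> by (intro mult_left_mono) auto
    finally show ?thesis by (simp add: mult_ac)
  next
    case False
    have "\<bar>x s\<bar> \<le> Y * E s" using Y[of s] False that by simp
    also have "\<dots> \<le> (Y + \<Phi>) * (\<eta> * E t)"
      using E_delay[OF that(3)] \<open>0 \<le> Y\<close> \<open>0 \<le> \<Phi>\<close> E_pos[of s] by (intro mult_mono) auto
    finally show ?thesis by (simp add: mult_ac)
  qed
  define D' where "D' = max \<Phi> (Y * 1)"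
  have x_bound: "\<bar>x s\<bar> \<le> D'" if "s \<le> T" for s
  proof (cases "s \<le> \<sigma>")
    case False
    then have "\<bar>x s\<bar> \<le> Y * E s" using Y[of s] that by simp
    also have "\<dots> \<le> Y * 1" using \<open>0 \<le> Y\<close> False \<gamma> by (intro mult_left_mono) (auto simp: E_def)
    finally show ?thesis by (simp add: D'_def)
  qed (use data in \<open>auto simp: D'_def le_max_iff_disj\<close>)
  \<comment> \<open>Freezing the value at \<sigma> makes increments across \<sigma> depend only on
    x' after \<sigma>.\<close>
  define xt where "xt s = x (max s \<sigma>)" for s
  have xt_meas: "xt \<in> borel_measurable borel" unfolding xt_def using x(2) by measurable
  have xt_bound: "\<bar>xt s\<bar> \<le> D'" if "s \<le> T" for s
    unfolding xt_def using x_bound[of "max s \<sigma>"] that \<open>\<sigma> \<le> T\<close> by auto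
  \<comment> \<open>The essential supremum of \<open>\<bar>x'\<bar> / E\<close> is approached through its upper bounds \<open>z\<close>.\<close>
  define admissible where "admissible z \<longleftrightarrow> 0 \<le> z \<and>
    (\<exists>N. negligible N \<and> (\<forall>t\<in>{\<sigma>..T} - N. \<bar>deriv x t\<bar> \<le> z * E t))" for z
  have step: "admissible (\<rho> * \<alpha> * (z + \<Phi>) + \<rho> * \<omega> * (Y + \<Phi>)) \<and>
      Y \<le> \<Phi> + \<rho> * (p1 * (z + \<Phi>) + q * (Y + \<Phi>) + 2 * \<Phi> + p2 * z)"
    if adm: "admissible z" for z
  proof -
    obtain Nz where Nz: "negligible Nz" "\<And>t. t \<in> {\<sigma>..T} - Nz \<Longrightarrow> \<bar>deriv x t\<bar> \<le> z * E t"
      and "0 \<le> z"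
      using adm unfolding admissible_def by blast
    \<comment> \<open>The bound \<open>z\<close> on x' holds only off \<open>Nz\<close>, so the
      times at which \<open>g\<close> lands in \<open>Nz\<close> are discarded too; they form a null
      set because preimages of null sets under \<open>g\<close> are null.\<close>
    define N1 where "N1 = N \<union> Nz \<union> {t \<in> {\<sigma>..T}. g t \<in> Nz}"
    have N1: "negligible N1" unfolding N1_def using N Nz g_null by auto
    have deriv_g: "\<bar>deriv_from \<sigma> \<psi> x (g t)\<bar> \<le> \<eta> * (z + \<Phi>) * E t" if t: "t \<in> {\<sigma>..T} - N1" for t
    proof (cases "g t < \<sigma>")
      case True
      have "\<bar>\<psi> (g t)\<bar> \<le> (z + \<Phi>) * 1" using data(2)[OF True] \<open>0 \<le> z\<close> by simp
      also have "\<dots> \<le> (z + \<Phi>) * (\<eta> * E t)"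
        using E_start[of t "g t"] g[of t] t True \<open>0 \<le> z\<close> \<open>0 \<le> \<Phi>\<close> by (intro mult_left_mono) auto
      finally show ?thesis using True by (simp add: deriv_from_def mult_ac)
    next
      case False
      have "\<bar>deriv x (g t)\<bar> \<le> z * E (g t)" using Nz(2)[of "g t"] g[of t] t False by (auto simp: N1_def)
      also have "\<dots> \<le> (z + \<Phi>) * (\<eta> * E t)"
        using E_delay[of t "g t"] g[of t] t \<open>0 \<le> z\<close> \<open>0 \<le> \<Phi>\<close> E_pos[of "g t"] by (intro mult_mono) auto
      finally show ?thesis using False by (simp add: deriv_from_def mult_ac)
    qed
    have increment: "\<bar>xt s' - xt s\<bar> \<le> \<eta> * z * E t * p2"
      if "t \<in> {\<sigma>..T}" "t - s \<le> d" "s \<le> s'" "s' \<le> t" "s' - s \<le> p2" for s s' t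
    proof -
      define r where "r = max s \<sigma>"
      define r' where "r' = max s' \<sigma>"
      have "\<bar>x r' - x r\<bar> \<le> z * (\<eta> * E t) * (r' - r)"
      proof (rule abs_cont_Icc_diff_le)
        show "r \<le> r'" "abs_cont_Icc r r' x"
          using that by (auto simp: r_def r'_def intro!: abs_cont_Icc_subset[OF x(1)])
        fix v assume v: "r \<le> v" "v < r'" "v \<notin> N1"
        then have v': "v \<in> {\<sigma>..T} - N1" using that by (auto simp: r_def r'_def)
        then have "\<bar>deriv x v\<bar> \<le> z * E v" "x differentiable at v"
          using Nz(2)[of v] eq[of v] by (auto simp: N1_def)
        moreover have "E v \<le> \<eta> * E t" using v that by (intro E_delay) (auto simp: r_def)
        then have "z * E v \<le> z * (\<eta> * E t)" using \<open>0 \<le> z\<close> by (rule mult_left_mono)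
        ultimately show "\<exists>y. \<bar>y\<bar> \<le> z * (\<eta> * E t) \<and> (x has_real_derivative y) (at v within {v..})"
          by (intro exI[of _ "deriv x v"])
            (auto simp: DERIV_deriv_iff_real_differentiable intro: has_field_derivative_at_within)
      qed (rule N1)
      also have "\<dots> \<le> z * (\<eta> * E t) * p2"
        using that \<open>0 \<le> z\<close> \<open>1 \<le> \<eta>\<close> E_pos[of t] nonneg
        by (intro mult_left_mono) (auto simp: r_def r'_def max_def)
      finally show ?thesis by (simp add: xt_def r_def r'_def mult_ac)
    qed
    have bounds: "\<bar>deriv x t\<bar> \<le> (\<rho> * \<alpha> * (z + \<Phi>) + \<rho> * \<omega> * (Y + \<Phi>)) * E t \<and>
        \<bar>deriv x t + c t * (LINT s|M t. xt (max s (H t)))\<bar>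
          \<le> c t * (\<eta> * (p1 * (z + \<Phi>) + q * (Y + \<Phi>) + 2 * \<Phi> + p2 * z)) * E t"
      if t: "t \<in> {\<sigma>..T} - N1" for t
    proof -
      have tN: "t \<in> {\<sigma>..T} - N" using t by (auto simp: N1_def)
      interpret prob_space "M t" using M[OF tN] by blast
      have sets[measurable_cong]: "sets (M t) = sets borel" and AE: "AE s in M t. h t \<le> s \<and> s \<le> t"
        using M[OF tN] by auto
      have ht: "h t \<le> H t" "H t \<le> t" "t - h t \<le> d" using h[of t] t by auto
      have int1: "integrable (M t) x"
        by (rule integrable_const_bound[of _ D'])
          (use x(2) t in \<open>auto intro!: eventually_mono[OF AE] x_bound\<close>)
      have int2: "integrable (M t) xt"
        by (rule integrable_const_bound[of _ D'])
          (use xt_meas t in \<open>auto intro!: eventually_mono[OF AE] xt_bound\<close>)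
      have int3: "integrable (M t) (\<lambda>s. xt (max s (H t)))"
        by (rule integrable_const_bound[of _ D'])
          (use xt_meas t ht in \<open>auto intro!: eventually_mono[OF AE] xt_bound\<close>)
      have mean: "\<bar>LINT s|M t. f s\<bar> \<le> m"
        if "integrable (M t) f" "\<And>s. h t \<le> s \<Longrightarrow> s \<le> t \<Longrightarrow> \<bar>f s\<bar> \<le> m" for f :: "real \<Rightarrow> real" and m
      proof -
        have "(LINT s|M t. f s) \<le> m"
          by (rule integral_le_const[OF that(1)], rule eventually_mono[OF AE])
            (use that(2) in \<open>auto simp: abs_le_iff\<close>)
        moreover have "- m \<le> (LINT s|M t. f s)"
          by (rule integral_ge_const[OF that(1)], rule eventually_mono[OF AE])
            (use that(2) in \<open>auto simp: abs_le_iff minus_le_iff\<close>)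
        ultimately show ?thesis by (simp add: abs_le_iff)
      qed
      \<comment> \<open>\<open>I\<close> is the true average, \<open>I1\<close> has the history
        frozen, and \<open>I2\<close> in addition moves the part of the window before
        \<open>H t\<close> to \<open>H t\<close>. Up to the weight, the first change costs 2 \<Phi>
        and the second an increment of \<open>xt\<close> over a length of at most
        \<open>p2\<close>.\<close>
      define I where "I = (LINT s|M t. x s)"
      define I1 where "I1 = (LINT s|M t. xt s)"
      define I2 where "I2 = (LINT s|M t. xt (max s (H t)))"
      have I: "\<bar>I\<bar> \<le> \<eta> * (Y + \<Phi>) * E t"
        unfolding I_def using int1 by (rule mean) (use t ht in \<open>auto intro!: x_le\<close>)
      have "\<bar>LINT s|M t. x s - xt s\<bar> \<le> 2 * \<Phi> * (\<eta> * E t)"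
      proof (rule mean)
        show "integrable (M t) (\<lambda>s. x s - xt s)" using int1 int2 by simp
        fix s assume s: "h t \<le> s" "s \<le> t"
        show "\<bar>x s - xt s\<bar> \<le> 2 * \<Phi> * (\<eta> * E t)"
        proof (cases "s < \<sigma>")
          case True
          have "\<bar>x s - xt s\<bar> \<le> 2 * \<Phi> * 1"
            using data(1)[of s] data(1)[of \<sigma>] True by (auto simp: xt_def)
          also have "\<dots> \<le> 2 * \<Phi> * (\<eta> * E t)"
            using E_start[of t s] s ht True \<open>0 \<le> \<Phi>\<close> by (intro mult_left_mono) auto
          finally show ?thesis .
        next
          case False
          then show ?thesis using \<open>0 \<le> \<Phi>\<close> \<open>1 \<le> \<eta>\<close> E_pos[of t] by (simp add: xt_def)
        qed
      qed
      then have I_I1: "\<bar>I - I1\<bar> \<le> 2 * \<Phi> * (\<eta> * E t)"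
        using int1 int2 by (simp add: I_def I1_def)
      have "\<bar>LINT s|M t. xt (max s (H t)) - xt s\<bar> \<le> \<eta> * z * E t * p2"
      proof (rule mean)
        show "integrable (M t) (\<lambda>s. xt (max s (H t)) - xt s)" using int2 int3 by simp
        fix s assume s: "h t \<le> s" "s \<le> t"
        have "H t - h t \<le> p2" using coef[OF tN] by blast
        then show "\<bar>xt (max s (H t)) - xt s\<bar> \<le> \<eta> * z * E t * p2"
          using s ht t nonneg by (intro increment) auto
      qed
      then have I1_I2: "\<bar>I2 - I1\<bar> \<le> \<eta> * z * E t * p2"
        using int2 int3 by (simp add: I1_def I2_def)
      define X where "X = deriv_from \<sigma> \<psi> x (g t)"
      have X: "\<bar>X\<bar> \<le> \<eta> * (z + \<Phi>) * E t" unfolding X_def using deriv_g[OF t] .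
      have eqt: "deriv x t = a t * X - b t * I"
        using eq[OF tN] t by (auto simp: deriv_from_def X_def I_def)
      have ct: "0 \<le> c t" "0 \<le> b t" and abt: "\<bar>a t\<bar> \<le> \<alpha>" "\<bar>a t\<bar> \<le> p1 * c t" "c t \<le> b t" "b t \<le> \<omega>"
        "b t - c t \<le> q * c t"
        using c(2)[of t] coef[OF tN] t \<gamma> by auto
      have "\<bar>deriv x t\<bar> \<le> \<bar>a t\<bar> * \<bar>X\<bar> + b t * \<bar>I\<bar>"
        unfolding eqt using abs_triangle_ineq4[of "a t * X" "b t * I"] ct by (simp add: abs_mult)
      also have "\<dots> \<le> \<alpha> * (\<eta> * (z + \<Phi>) * E t) + \<omega> * (\<eta> * (Y + \<Phi>) * E t)"
        using abt X I nonneg by (intro add_mono mult_mono) auto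
      also have "\<dots> = \<eta> * ((\<alpha> * (z + \<Phi>) + \<omega> * (Y + \<Phi>)) * E t)" by (simp add: algebra_simps)
      also have "\<dots> \<le> \<rho> * ((\<alpha> * (z + \<Phi>) + \<omega> * (Y + \<Phi>)) * E t)"
        using \<open>\<eta> \<le> \<rho>\<close> nonneg \<open>0 \<le> z\<close> \<open>0 \<le> \<Phi>\<close> \<open>0 \<le> Y\<close> E_pos[of t] by (intro mult_right_mono) auto
      finally have 1: "\<bar>deriv x t\<bar> \<le> (\<rho> * \<alpha> * (z + \<Phi>) + \<rho> * \<omega> * (Y + \<Phi>)) * E t"
        by (simp add: algebra_simps)
      \<comment> \<open>The comparison bounds a solution by the quotient of forcing and
        \<open>c\<close>, so each of the four errors is estimated by a multiple of
        \<open>c t\<close>: the neutral term through \<open>p1\<close>, the excess of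
        \<open>b\<close> over \<open>c\<close> through \<open>q\<close>, then the history and the
        shortened window.\<close>
      have "deriv x t + c t * I2 = a t * X - (b t - c t) * I - c t * (I - I1) + c t * (I2 - I1)"
        unfolding eqt by (simp add: algebra_simps)
      also have "\<bar>\<dots>\<bar> \<le> \<bar>a t * X\<bar> + \<bar>(b t - c t) * I\<bar> + \<bar>c t * (I - I1)\<bar> + \<bar>c t * (I2 - I1)\<bar>"
        by linarith
      also have "\<dots> = \<bar>a t\<bar> * \<bar>X\<bar> + (b t - c t) * \<bar>I\<bar> + c t * \<bar>I - I1\<bar> + c t * \<bar>I2 - I1\<bar>"
        using ct abt by (simp add: abs_mult)
      also have "\<dots> \<le> p1 * c t * (\<eta> * (z + \<Phi>) * E t) + q * c t * (\<eta> * (Y + \<Phi>) * E t)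
          + c t * (2 * \<Phi> * (\<eta> * E t)) + c t * (\<eta> * z * E t * p2)"
        using abt ct X I I_I1 I1_I2 nonneg by (intro add_mono mult_mono) auto
      also have "\<dots> = c t * (\<eta> * (p1 * (z + \<Phi>) + q * (Y + \<Phi>) + 2 * \<Phi> + p2 * z)) * E t"
        by (simp add: algebra_simps)
      finally show ?thesis using 1 unfolding I2_def by blast
    qed
    define Q where "Q = p1 * (z + \<Phi>) + q * (Y + \<Phi>) + 2 * \<Phi> + p2 * z"
    have "0 \<le> Q" unfolding Q_def using nonneg \<open>0 \<le> z\<close> \<open>0 \<le> \<Phi>\<close> \<open>0 \<le> Y\<close> by auto
    \<comment> \<open>\<Phi> covers the starting value and \<open>\<rho> * Q\<close> the forcing:
      the hypothesis \<open>exp (\<gamma> * d) \<le> \<rho> * (1 - \<gamma> / \<kappa>)\<close>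
      turns the factor \<eta> in the bound on the forcing into the factor
      \<open>1 - \<gamma> / \<kappa>\<close> that the comparison asks for.\<close>
    define K where "K = \<Phi> + \<rho> * Q"
    have "\<Phi> \<le> K" unfolding K_def using \<open>0 \<le> Q\<close> \<open>0 < \<rho>\<close> by simp
    \<comment> \<open>The image of \<open>M t\<close> under \<open>max s (H t)\<close> moves all
      mass before \<open>H t\<close> to the point \<open>H t\<close>. It remains a probability
      measure and lives on the short window, as the comparison needs.\<close>
    have comparison: "\<bar>xt r\<bar> \<le> K * exp (- \<gamma> * (r - \<sigma>))" if "r \<in> {\<sigma>..T}" for r
    proof (rule delay_exponential_comparison[where M = "\<lambda>t. distr (M t) borel (\<lambda>s. max s (H t))"])
      show "abs_cont_Icc \<sigma> T xt"
        using x(1) by (rule abs_cont_Icc_cong) (simp add: xt_def)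
      show "bounded (xt ` {..T})" using xt_bound by (auto simp: bounded_iff)
      show "xt s = xt \<sigma>" if "s \<le> \<sigma>" for s using that by (simp add: xt_def)
      show "\<bar>xt \<sigma>\<bar> \<le> K" using data(1)[of \<sigma>] \<open>\<Phi> \<le> K\<close> by (simp add: xt_def)
      show "H t \<le> t \<and> integral {max \<sigma> (H t)..t} c \<le> 1 / exp 1" if "\<sigma> \<le> t" "t \<le> T" for t
        using H[OF that] h[OF that] by blast
      fix t assume t: "\<sigma> \<le> t" "t < T" "t \<notin> N1"
      then have t1: "t \<in> {\<sigma>..T} - N1" and tN: "t \<in> {\<sigma>..T} - N" by (auto simp: N1_def)
      have sets[measurable_cong]: "sets (M t) = sets borel" and AE: "AE s in M t. h t \<le> s \<and> s \<le> t"
        and prob: "prob_space (M t)"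
        using M[OF tN] by auto
      show "prob_space (distr (M t) borel (\<lambda>s. max s (H t))) \<and>
          sets (distr (M t) borel (\<lambda>s. max s (H t))) = sets borel \<and>
          (AE s in distr (M t) borel (\<lambda>s. max s (H t)). H t \<le> s \<and> s \<le> t)"
      proof (intro conjI)
        show "prob_space (distr (M t) borel (\<lambda>s. max s (H t)))"
          using prob by (rule prob_space.prob_space_distr) measurable
        show "AE s in distr (M t) borel (\<lambda>s. max s (H t)). H t \<le> s \<and> s \<le> t"
          by (subst AE_distr_iff) (use h[of t] t in \<open>auto intro!: eventually_mono[OF AE]\<close>)
      qed simp
      have int: "(LINT s|distr (M t) borel (\<lambda>s. max s (H t)). xt s) = (LINT s|M t. xt (max s (H t)))"
        by (rule integral_distr) (use xt_meas in measurable)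
      have "c t * (\<eta> * Q) * E t \<le> c t * ((\<rho> * (1 - \<gamma> / \<kappa>)) * Q) * E t"
        using \<rho> \<open>0 \<le> Q\<close> c(2)[of t] t \<gamma> E_pos[of t] unfolding \<eta>_def
        by (intro mult_right_mono mult_left_mono) auto
      also have "\<dots> = c t * (1 - \<gamma> / \<kappa>) * (\<rho> * Q) * E t" by (simp add: mult_ac)
      also have "\<dots> \<le> c t * (1 - \<gamma> / \<kappa>) * K * E t"
        using \<open>0 \<le> \<Phi>\<close> c(2)[of t] t \<gamma> \<kappa> E_pos[of t] unfolding K_def
        by (intro mult_right_mono mult_left_mono) auto
      finally have "\<bar>deriv x t + c t * (LINT s|M t. xt (max s (H t)))\<bar> \<le> c t * (1 - \<gamma> / \<kappa>) * K * E t"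
        using bounds[OF t1] unfolding Q_def by linarith
      moreover have "(x has_real_derivative deriv x t) (at t within {t..})"
        using eq[OF tN]
        by (auto simp: DERIV_deriv_iff_real_differentiable intro: has_field_derivative_at_within)
      then have "(xt has_real_derivative deriv x t) (at t within {t..})"
        by (rule has_field_derivative_transform_within[of _ _ _ _ 1]) (use t in \<open>auto simp: xt_def\<close>)
      ultimately show "\<exists>y. (xt has_real_derivative y) (at t within {t..}) \<and>
          \<bar>y + c t * (LINT s|distr (M t) borel (\<lambda>s. max s (H t)). xt s)\<bar>
            \<le> c t * (1 - \<gamma> / \<kappa>) * K * exp (- \<gamma> * (t - \<sigma>))"
        unfolding int E_def by blast
    qed (use xt_meas \<gamma> c N1 that in auto)
    have "Y \<le> K"
      using comparison[OF t1] t1 E_pos[of t1] unfolding Y_def by (simp add: pos_divide_le_eq xt_def E_def)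
    moreover have "admissible (\<rho> * \<alpha> * (z + \<Phi>) + \<rho> * \<omega> * (Y + \<Phi>))"
      unfolding admissible_def using bounds N1 \<open>0 < \<rho>\<close> nonneg \<open>0 \<le> z\<close> \<open>0 \<le> \<Phi>\<close> \<open>0 \<le> Y\<close> by auto
    ultimately show ?thesis unfolding K_def Q_def by blast
  qed
  define Z where "Z = Inf (Collect admissible)"
  \<comment> \<open>On the bounded interval \<open>E\<close> is at least \<open>E T\<close>, so the
    unweighted bound \<open>D\<close> already yields an admissible value, and \<open>Z\<close> is a
    genuine infimum.\<close>
  have "admissible (max D 0 / E T)"
    unfolding admissible_def
  proof (intro conjI exI[of _ N] ballI)
    fix t assume t: "t \<in> {\<sigma>..T} - N"
    have "\<bar>deriv x t\<bar> \<le> max D 0" using eq[OF t] by (auto simp: le_max_iff_disj)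
    also have "\<dots> = max D 0 / E T * E T" using E_pos[of T] by simp
    also have "\<dots> \<le> max D 0 / E T * E t"
      using E_pos[of T] t \<gamma> by (intro mult_left_mono) (auto simp: E_def)
    finally show "\<bar>deriv x t\<bar> \<le> max D 0 / E T * E t" .
  qed (use N E_pos[of T] in auto)
  then have ne: "Collect admissible \<noteq> {}" by blast
  have bdd: "bdd_below (Collect admissible)" by (auto simp: admissible_def intro!: bdd_belowI[of _ 0])
  have Z_le: "Z \<le> z" if "admissible z" for z
    unfolding Z_def using that bdd by (auto intro: cInf_lower)
  have Z_ge: "v \<le> Z" if "\<And>z. admissible z \<Longrightarrow> v \<le> z" for v
    unfolding Z_def using ne that by (auto intro: cInf_greatest)
  define p where "p = p1 + p2"
  have "0 \<le> p" unfolding p_def using nonneg by simp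
  \<comment> \<open>The bounds in \<open>step\<close> are affine in \<open>z\<close>; the infimum is
    reached by solving them for \<open>z\<close>. This divides by the coefficient of
    \<open>z\<close>, hence the separate case in which it vanishes, here and in
    \<open>Y1\<close>.\<close>
  have Z1: "Z * (1 - \<rho> * \<alpha>) \<le> \<rho> * (\<alpha> + \<omega>) * \<Phi> + \<rho> * \<omega> * Y"
  proof (cases "\<alpha> = 0")
    case True
    obtain z where "admissible z" using ne by blast
    from Z_le[OF conjunct1[OF step[OF this]]] True show ?thesis by (simp add: algebra_simps)
  next
    case False
    then have "0 < \<rho> * \<alpha>" using nonneg \<open>0 < \<rho>\<close> by simp
    have "(Z - \<rho> * \<alpha> * \<Phi> - \<rho> * \<omega> * (Y + \<Phi>)) / (\<rho> * \<alpha>) \<le> Z"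
    proof (rule Z_ge)
      fix z assume "admissible z"
      from Z_le[OF conjunct1[OF step[OF this]]]
      show "(Z - \<rho> * \<alpha> * \<Phi> - \<rho> * \<omega> * (Y + \<Phi>)) / (\<rho> * \<alpha>) \<le> z"
        using \<open>0 < \<rho> * \<alpha>\<close> by (simp add: pos_divide_le_eq algebra_simps)
    qed
    then show ?thesis using \<open>0 < \<rho> * \<alpha>\<close> by (simp add: pos_divide_le_eq algebra_simps)
  qed
  have Y1: "Y * (1 - \<rho> * q) \<le> \<Phi> * (1 + \<rho> * (p1 + q + 2)) + \<rho> * p * Z"
  proof (cases "p = 0")
    case True
    then have "p1 = 0" "p2 = 0" using nonneg unfolding p_def by auto
    obtain z where "admissible z" using ne by blast
    from conjunct2[OF step[OF this]] True \<open>p1 = 0\<close> \<open>p2 = 0\<close> show ?thesis by (simp add: algebra_simps)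
  next
    case False
    then have "0 < \<rho> * p" using \<open>0 \<le> p\<close> \<open>0 < \<rho>\<close> by simp
    have "(Y * (1 - \<rho> * q) - \<Phi> * (1 + \<rho> * (p1 + q + 2))) / (\<rho> * p) \<le> Z"
    proof (rule Z_ge)
      fix z assume "admissible z"
      from conjunct2[OF step[OF this]]
      show "(Y * (1 - \<rho> * q) - \<Phi> * (1 + \<rho> * (p1 + q + 2))) / (\<rho> * p) \<le> z"
        using \<open>0 < \<rho> * p\<close> by (simp add: pos_divide_le_eq) (simp add: p_def algebra_simps)
    qed
    then show ?thesis using \<open>0 < \<rho> * p\<close> by (simp add: pos_divide_le_eq algebra_simps)
  qed
  have "Z \<le> (\<rho> * (\<alpha> + \<omega>) * \<Phi> + \<rho> * \<omega> * Y) / (1 - \<rho> * \<alpha>)"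
    using Z1 \<rho>\<alpha> by (simp add: pos_le_divide_eq)
  then have "\<rho> * p * Z \<le> \<rho> * p * ((\<rho> * (\<alpha> + \<omega>) * \<Phi> + \<rho> * \<omega> * Y) / (1 - \<rho> * \<alpha>))"
    using \<open>0 < \<rho>\<close> \<open>0 \<le> p\<close> by (intro mult_left_mono) auto
  also have "\<dots> = \<rho> * p * (\<rho> * (\<alpha> + \<omega>) / (1 - \<rho> * \<alpha>)) * \<Phi> + \<rho> * p * (\<rho> * \<omega> / (1 - \<rho> * \<alpha>)) * Y"
    by (simp add: add_divide_distrib algebra_simps)
  finally have "Y * \<theta> \<le> (1 + \<rho> * (p1 + q + 2) + \<rho> * p * (\<rho> * (\<alpha> + \<omega>) / (1 - \<rho> * \<alpha>))) * \<Phi>"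
    using Y1 unfolding \<theta>(1) p_def[symmetric] by (simp add: algebra_simps)
  then have "Y \<le> (1 + \<rho> * (p1 + q + 2) + \<rho> * p * (\<rho> * (\<alpha> + \<omega>) / (1 - \<rho> * \<alpha>))) * \<Phi> / \<theta>"
    using \<theta>(2) by (simp add: pos_le_divide_eq)
  then have "Y * E t \<le> (1 + \<rho> * (p1 + q + 2) + \<rho> * p * (\<rho> * (\<alpha> + \<omega>) / (1 - \<rho> * \<alpha>))) * \<Phi> / \<theta> * E t"
    using E_pos[of t] by (intro mult_right_mono) auto
  then show ?thesis using Y[of t] t unfolding p_def E_def by simp
qed

section \<open>Exponential stability\<close>

text \<open>At \<rho> = 1 the requirements on \<rho> alone are the assumed strict inequalities,
  which persist slightly to the right of 1. The requirement linking \<rho> and \<gamma> is an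
  equality at \<rho> = 1, \<gamma> = 0; for a fixed \<rho> > 1 it is strict at \<gamma> = 0 and
  leaves room for a positive \<gamma>.\<close>

lemma exists_decay_rate:
  fixes \<alpha> p q \<omega> \<kappa> d :: real
  assumes "\<alpha> < 1" "p * \<omega> / (1 - \<alpha>) + q < 1" "0 < \<kappa>"
  obtains \<rho> \<gamma> where "0 < \<gamma>" "\<gamma> < \<kappa>" "exp (\<gamma> * d) \<le> \<rho> * (1 - \<gamma> / \<kappa>)" "1 < \<rho>" "\<rho> * \<alpha> < 1"
    and "0 < 1 - \<rho> * q - \<rho> * p * (\<rho> * \<omega> / (1 - \<rho> * \<alpha>))"
proof -
  have "((\<lambda>\<rho>. 1 - \<rho> * q - \<rho> * p * (\<rho> * \<omega> / (1 - \<rho> * \<alpha>))) \<longlongrightarrow>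
      1 - 1 * q - 1 * p * (1 * \<omega> / (1 - 1 * \<alpha>))) (at_right 1)"
    using assms(1) by (intro tendsto_intros) auto
  then have "\<forall>\<^sub>F \<rho> in at_right 1. 0 < 1 - \<rho> * q - \<rho> * p * (\<rho> * \<omega> / (1 - \<rho> * \<alpha>))"
    by (rule order_tendstoD) (use assms(2) in simp)
  moreover have "((\<lambda>\<rho>. \<rho> * \<alpha>) \<longlongrightarrow> 1 * \<alpha>) (at_right 1)" by (intro tendsto_intros)
  then have "\<forall>\<^sub>F \<rho> in at_right 1. \<rho> * \<alpha> < 1" by (rule order_tendstoD) (use assms(1) in simp)
  moreover have "\<forall>\<^sub>F \<rho> in at_right 1. (1 :: real) < \<rho>" by (rule eventually_at_right_less)
  ultimately have "\<forall>\<^sub>F \<rho> in at_right 1. 1 < \<rho> \<and> \<rho> * \<alpha> < 1 \<and>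
      0 < 1 - \<rho> * q - \<rho> * p * (\<rho> * \<omega> / (1 - \<rho> * \<alpha>))"
    by eventually_elim simp
  then obtain \<rho> where \<rho>: "1 < \<rho>" "\<rho> * \<alpha> < 1" "0 < 1 - \<rho> * q - \<rho> * p * (\<rho> * \<omega> / (1 - \<rho> * \<alpha>))"
    using eventually_happens'[OF trivial_limit_at_right_real] by blast
  have "((\<lambda>\<gamma>. exp (\<gamma> * d) - \<rho> * (1 - \<gamma> / \<kappa>)) \<longlongrightarrow> exp (0 * d) - \<rho> * (1 - 0 / \<kappa>)) (at_right 0)"
    using assms(3) by (intro tendsto_intros) auto
  then have "\<forall>\<^sub>F \<gamma> in at_right 0. exp (\<gamma> * d) - \<rho> * (1 - \<gamma> / \<kappa>) < 0"
    by (rule order_tendstoD) (use \<rho>(1) in simp)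
  moreover have "\<forall>\<^sub>F \<gamma> in at_right 0. 0 < \<gamma> \<and> \<gamma> < \<kappa>"
    unfolding eventually_at_right[OF assms(3)] using assms(3) by blast
  ultimately have "\<forall>\<^sub>F \<gamma> in at_right 0. exp (\<gamma> * d) - \<rho> * (1 - \<gamma> / \<kappa>) < 0 \<and> 0 < \<gamma> \<and> \<gamma> < \<kappa>"
    by eventually_elim simp
  then obtain \<gamma> where "exp (\<gamma> * d) - \<rho> * (1 - \<gamma> / \<kappa>) < 0" "0 < \<gamma>" "\<gamma> < \<kappa>"
    using eventually_happens'[OF trivial_limit_at_right_real] by blast
  with \<rho> show thesis by (intro that[of \<gamma> \<rho>]) auto
qed

section \<open>Essential norms, initial data and measurability of solutions\<close>

lemma ess_norm_bounds:
  assumes f: "f \<in> borel_measurable (lebesgue_on {t0..})" and C: "AE t in lebesgue_on {t0..}. \<bar>f t\<bar> \<le> C"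
  shows "AE t in lebesgue_on {t0..}. \<bar>f t\<bar> \<le> ess_norm t0 f"
    and "0 \<le> ess_norm t0 f" and "ess_norm t0 f \<le> C"
proof -
  let ?L = "lebesgue_on {t0..}"
  define e where "e = esssup ?L (\<lambda>t. ereal \<bar>f t\<bar>)"
  have meas: "(\<lambda>t. ereal \<bar>f t\<bar>) \<in> borel_measurable ?L" using f by measurable
  have "e \<le> ereal C" unfolding e_def by (rule esssup_I[OF meas]) (use C in simp)
  \<comment> \<open>On a space of measure zero the essential supremum would be minus infinity.
    Positive measure of the half-line gives \<open>0 \<le> e\<close>, and together with the bound
    \<open>C\<close> this makes the conversion to a real number faithful.\<close>
  have "emeasure ?L (space ?L) = emeasure lebesgue {t0..}"
    by (simp add: emeasure_restrict_space)
  also have "\<dots> \<noteq> 0"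
  proof
    assume "emeasure lebesgue {t0..} = 0"
    moreover have "emeasure lebesgue {t0..t0 + 1} \<le> emeasure lebesgue {t0..}"
      by (intro emeasure_mono) auto
    ultimately show False by simp
  qed
  finally have "esssup ?L (\<lambda>_. 0 :: ereal) = 0" by (rule esssup_const)
  moreover have "esssup ?L (\<lambda>_. 0 :: ereal) \<le> e"
    unfolding e_def by (rule esssup_mono) auto
  ultimately have "0 \<le> e" by simp
  with \<open>e \<le> ereal C\<close> have e: "e = ereal (ess_norm t0 f)"
    unfolding ess_norm_def e_def[symmetric] by (cases e) auto
  show "0 \<le> ess_norm t0 f" "ess_norm t0 f \<le> C"
    using \<open>0 \<le> e\<close> \<open>e \<le> ereal C\<close> unfolding e by auto
  have "AE t in ?L. ereal \<bar>f t\<bar> \<le> e" unfolding e_def by (rule esssup_AE)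
  then show "AE t in ?L. \<bar>f t\<bar> \<le> ess_norm t0 f" unfolding e by simp
qed

lemma initial_data_le_SUP:
  assumes "initial_data \<sigma> \<phi> \<psi>"
  shows "s \<le> \<sigma> \<Longrightarrow> \<bar>\<phi> s\<bar> \<le> (SUP s\<in>{..\<sigma>}. \<bar>\<phi> s\<bar> + \<bar>if s < \<sigma> then \<psi> s else 0\<bar>)"
    and "s < \<sigma> \<Longrightarrow> \<bar>\<psi> s\<bar> \<le> (SUP s\<in>{..\<sigma>}. \<bar>\<phi> s\<bar> + \<bar>if s < \<sigma> then \<psi> s else 0\<bar>)"
proof -
  obtain C1 C2 where C: "\<And>s. s \<le> \<sigma> \<Longrightarrow> \<bar>\<phi> s\<bar> \<le> C1" "\<And>s. s < \<sigma> \<Longrightarrow> \<bar>\<psi> s\<bar> \<le> C2"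
    using assms unfolding initial_data_def bounded_iff by auto
  have bdd: "bdd_above ((\<lambda>s. \<bar>\<phi> s\<bar> + \<bar>if s < \<sigma> then \<psi> s else 0\<bar>) ` {..\<sigma>})"
  proof (rule bdd_aboveI2)
    fix s assume "s \<in> {..\<sigma>}"
    then show "\<bar>\<phi> s\<bar> + \<bar>if s < \<sigma> then \<psi> s else 0\<bar> \<le> C1 + \<bar>C2\<bar>"
      using C(1)[of s] C(2)[of s] by auto
  qed
  show "\<bar>\<phi> s\<bar> \<le> (SUP s\<in>{..\<sigma>}. \<bar>\<phi> s\<bar> + \<bar>if s < \<sigma> then \<psi> s else 0\<bar>)" if "s \<le> \<sigma>"
    by (rule cSUP_upper2[OF bdd, of s]) (use that in auto)
  show "\<bar>\<psi> s\<bar> \<le> (SUP s\<in>{..\<sigma>}. \<bar>\<phi> s\<bar> + \<bar>if s < \<sigma> then \<psi> s else 0\<bar>)" if "s < \<sigma>"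
    by (rule cSUP_upper2[OF bdd, of s]) (use that in auto)
qed

text \<open>The kernel measures are defined on Borel sets, so \<open>x\<close> must be Borel
  measurable to be averaged. It is glued from the Borel history and countably many continuous
  pieces.\<close>

lemma is_solution_borel_measurable:
  assumes "initial_data \<sigma> \<phi> \<psi>" "is_solution a b g h B \<sigma> \<phi> \<psi> x"
  shows "x \<in> borel_measurable borel"
proof (rule measurable_piecewise_restrict[of "insert {..\<sigma>} (range (\<lambda>n. {\<sigma>..\<sigma> + real n}))"])
  show "space borel \<subseteq> \<Union> (insert {..\<sigma>} (range (\<lambda>n. {\<sigma>..\<sigma> + real n})))"
  proof
    fix s :: real
    obtain n :: nat where "s - \<sigma> < real n" using reals_Archimedean2 by blast
    then show "s \<in> \<Union> (insert {..\<sigma>} (range (\<lambda>n. {\<sigma>..\<sigma> + real n})))"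
      by (cases "s \<le> \<sigma>") (auto intro!: exI[of _ n])
  qed
  fix A assume "A \<in> insert {..\<sigma>} (range (\<lambda>n. {\<sigma>..\<sigma> + real n}))"
  then consider "A = {..\<sigma>}" | n where "A = {\<sigma>..\<sigma> + real n}" by blast
  then show "x \<in> borel_measurable (restrict_space borel A)"
  proof cases
    case 1
    have "x s = \<phi> s" if "s \<in> space (restrict_space borel {..\<sigma>})" for s
      using assms(2) that by (simp add: is_solution_def space_restrict_space)
    then have "x \<in> borel_measurable (restrict_space borel {..\<sigma>}) \<longleftrightarrow>
        \<phi> \<in> borel_measurable (restrict_space borel {..\<sigma>})"
      by (rule measurable_cong)
    then show ?thesis using assms(1) unfolding 1 initial_data_def by blast
  next
    case 2
    have "abs_cont_Icc \<sigma> (\<sigma> + real n) x" using assms(2) by (simp add: is_solution_def)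
    then show ?thesis
      unfolding 2 by (intro borel_measurable_continuous_on_restrict abs_cont_Icc_continuous_on)
  qed
qed auto

text \<open>
  The three cases of the theorem differ in the coefficient \<open>c\<close> of the comparison equation, in
  \<open>q\<close>, which measures \<open>b - c\<close>, and in the truncation \<open>H\<close> of the delay \<open>h\<close>.
\<close>

lemma exponentially_stableI:
  fixes a b c g h H :: "real \<Rightarrow> real" and B :: "real \<Rightarrow> real \<Rightarrow> real"
  assumes "0 \<le> t0" "0 \<le> d"
    and g: "\<And>t. t0 \<le> t \<Longrightarrow> g t \<le> t \<and> t - g t \<le> d"
    and h: "\<And>t. t0 \<le> t \<Longrightarrow> h t \<le> H t \<and> H t \<le> t \<and> t - h t \<le> d"
    and g_null: "\<And>E. E \<in> null_sets lebesgue \<Longrightarrow> {t \<in> {0..}. g t \<in> E} \<in> null_sets lebesgue"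
    and mono: "AE t in lebesgue_on {0..}. mono_on ({0..} \<union> {h t}) (zero_ext (B t))"
    and B0: "AE t in lebesgue_on {0..}. zero_ext (B t) (h t) = 0"
    and B1: "AE t in lebesgue_on {0..}. (B t \<longlongrightarrow> 1) (at_right t)"
    and c_meas: "c \<in> borel_measurable (lebesgue_on {t0..})"
    and "0 < \<kappa>" and c: "\<And>t. t0 \<le> t \<Longrightarrow> \<kappa> \<le> c t \<and> c t \<le> c1"
    and H: "\<And>t. t0 \<le> t \<Longrightarrow> integral {max t0 (H t)..t} c \<le> 1 / exp 1"
    and coef: "AE t in lebesgue_on {t0..}. \<bar>a t\<bar> \<le> \<alpha> \<and> \<bar>a t\<bar> \<le> p1 * c t \<and> c t \<le> b t \<and> b t \<le> \<omega> \<and>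
      b t - c t \<le> q * c t \<and> H t - h t \<le> p2"
    and nonneg: "0 \<le> \<alpha>" "0 \<le> \<omega>" "0 \<le> p1" "0 \<le> p2" "0 \<le> q"
    and contraction: "\<alpha> < 1" "(p1 + p2) * \<omega> / (1 - \<alpha>) + q < 1"
  shows "exponentially_stable t0 a b g h B"
proof -
  obtain \<rho> \<gamma> where \<gamma>: "0 < \<gamma>" "\<gamma> < \<kappa>" and \<rho>: "exp (\<gamma> * d) \<le> \<rho> * (1 - \<gamma> / \<kappa>)" "1 < \<rho>" "\<rho> * \<alpha> < 1"
    "0 < 1 - \<rho> * q - \<rho> * (p1 + p2) * (\<rho> * \<omega> / (1 - \<rho> * \<alpha>))"
    using exists_decay_rate[OF contraction \<open>0 < \<kappa>\<close>] by blast
  define \<theta> where "\<theta> = 1 - \<rho> * q - \<rho> * (p1 + p2) * (\<rho> * \<omega> / (1 - \<rho> * \<alpha>))"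
  define K where "K = (1 + \<rho> * (p1 + q + 2) +
    \<rho> * (p1 + p2) * (\<rho> * (\<alpha> + \<omega>) / (1 - \<rho> * \<alpha>))) / \<theta>"
  have "0 < \<theta>" using \<rho> by (simp add: \<theta>_def)
  have "0 < K"
    unfolding K_def using \<rho> nonneg \<open>0 < \<theta>\<close>
    by (intro divide_pos_pos add_pos_nonneg mult_nonneg_nonneg divide_nonneg_nonneg) auto
  have c_int: "c integrable_on {u..v}" if "t0 \<le> u" for u v
  proof (rule measurable_bounded_by_integrable_imp_integrable)
    show "c \<in> borel_measurable (lebesgue_on {u..v})"
      by (rule measurable_restrict_mono[OF c_meas]) (use \<open>t0 \<le> u\<close> in auto)
    show "(\<lambda>_. c1) integrable_on {u..v}" by (rule integrable_const_ivl)
    show "norm (c t) \<le> c1" if "t \<in> {u..v}" for t using c[of t] \<open>t0 \<le> u\<close> \<open>0 < \<kappa>\<close> that by auto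
  qed auto
  obtain N1 where N1: "negligible N1" and B: "\<And>t. t \<in> {0..} - N1 \<Longrightarrow>
      mono_on ({0..} \<union> {h t}) (zero_ext (B t)) \<and> zero_ext (B t) (h t) = 0 \<and> (B t \<longlongrightarrow> 1) (at_right t)"
    using AE_conjI[OF mono AE_conjI[OF B0 B1]] by (subst (asm) AE_lebesgue_on_negligible) auto
  obtain N2 where N2: "negligible N2" and coef': "\<And>t. t \<in> {t0..} - N2 \<Longrightarrow>
      \<bar>a t\<bar> \<le> \<alpha> \<and> \<bar>a t\<bar> \<le> p1 * c t \<and> c t \<le> b t \<and> b t \<le> \<omega> \<and>
      b t - c t \<le> q * c t \<and> H t - h t \<le> p2"
    using coef by (subst (asm) AE_lebesgue_on_negligible) auto
  have "\<bar>x t\<bar> \<le> K * exp (- \<gamma> * (t - \<sigma>)) * (SUP s\<in>{..\<sigma>}. \<bar>\<phi> s\<bar> + \<bar>if s < \<sigma> then \<psi> s else 0\<bar>)"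
    if "t0 \<le> \<sigma>" and init: "initial_data \<sigma> \<phi> \<psi>" and sol: "is_solution a b g h B \<sigma> \<phi> \<psi> x" and "\<sigma> \<le> t"
    for \<sigma> \<phi> \<psi> x t
  proof -
    define \<Phi> where "\<Phi> = (SUP s\<in>{..\<sigma>}. \<bar>\<phi> s\<bar> + \<bar>if s < \<sigma> then \<psi> s else 0\<bar>)"
    define M where "M t = stieltjes_Icc (zero_ext (B t)) (h t) t" for t
    have x_meas: "x \<in> borel_measurable borel" using is_solution_borel_measurable[OF init sol] .
    have sol1: "\<And>s. s \<le> \<sigma> \<Longrightarrow> x s = \<phi> s" "abs_cont_Icc \<sigma> t x"
      "AE s in lebesgue_on {\<sigma>..t}. x differentiable (at s)" "ess_bounded_on {\<sigma>..t} (deriv x)"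
      "AE t in lebesgue_on {\<sigma>..}. deriv_from \<sigma> \<psi> x t - a t * deriv_from \<sigma> \<psi> x (g t)
        + b t * (LINT s:{h t..t}|M t. x s) = 0"
      using sol \<open>\<sigma> \<le> t\<close> unfolding is_solution_def M_def by auto
    obtain N3 where N3: "negligible N3" "\<And>s. s \<in> {\<sigma>..t} - N3 \<Longrightarrow> x differentiable (at s)"
      using sol1(3) by (auto simp: AE_lebesgue_on_negligible)
    obtain D where "AE s in lebesgue_on {\<sigma>..t}. \<bar>deriv x s\<bar> \<le> D"
      using sol1(4) unfolding ess_bounded_on_def by blast
    then obtain N4 where N4: "negligible N4" "\<And>s. s \<in> {\<sigma>..t} - N4 \<Longrightarrow> \<bar>deriv x s\<bar> \<le> D"
      by (subst (asm) AE_lebesgue_on_negligible) auto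
    obtain N5 where N5: "negligible N5" "\<And>t. t \<in> {\<sigma>..} - N5 \<Longrightarrow>
        deriv_from \<sigma> \<psi> x t - a t * deriv_from \<sigma> \<psi> x (g t) + b t * (LINT s:{h t..t}|M t. x s) = 0"
      using sol1(5) by (auto simp: AE_lebesgue_on_negligible)
    define N where "N = N1 \<union> N2 \<union> N3 \<union> N4 \<union> N5"
    have prob: "prob_space (M r) \<and> sets (M r) = sets borel \<and> (AE s in M r. h r \<le> s \<and> s \<le> r)"
      if "r \<in> {\<sigma>..t} - N" for r
      unfolding M_def using prob_space_stieltjes_Icc[of r "h r" "B r"] B[of r] h[of r] that
        \<open>t0 \<le> \<sigma>\<close> \<open>0 \<le> t0\<close> by (auto simp: N_def)
    \<comment> \<open>The horizon is the time of evaluation itself; \<open>K\<close> and \<gamma>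
      were fixed before \<sigma>, the data and \<open>t\<close>.\<close>
    have "\<bar>x t\<bar> \<le> K * \<Phi> * exp (- \<gamma> * (t - \<sigma>))"
      unfolding K_def
    proof (rule solution_estimate[where T = t and c = c and H = H and N = N and M = M and D = D
          and \<psi> = \<psi> and g = g and h = h and a = a and b = b and \<omega> = \<omega> and \<kappa> = \<kappa> and d = d
          and ?c1.0 = c1])
      show "\<bar>x s\<bar> \<le> \<Phi>" if "s \<le> \<sigma>" for s
        unfolding \<Phi>_def using initial_data_le_SUP(1)[OF init that] sol1(1)[OF that] by simp
      show "\<bar>\<psi> s\<bar> \<le> \<Phi>" if "s < \<sigma>" for s
        unfolding \<Phi>_def using initial_data_le_SUP(2)[OF init that] .
      show "negligible {r \<in> {\<sigma>..t}. g r \<in> E}" if "negligible E" for E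
      proof (rule negligible_subset)
        show "negligible {r \<in> {0..}. g r \<in> E}"
          using g_null[of E] that by (simp add: negligible_iff_null_sets)
      qed (use \<open>0 \<le> t0\<close> \<open>t0 \<le> \<sigma>\<close> in auto)
      show "integral {max \<sigma> (H r)..r} c \<le> 1 / exp 1" if r: "\<sigma> \<le> r" "r \<le> t" for r
      proof -
        \<comment> \<open>The bound on \<open>c\<close> concerns windows cut at \<open>t0\<close>;
          they contain those cut at \<sigma>, and \<open>c\<close> is nonnegative there.\<close>
        have "integral {max \<sigma> (H r)..r} c \<le> integral {max t0 (H r)..r} c"
        proof (rule integral_subset_le)
          show "\<forall>s\<in>{max t0 (H r)..r}. 0 \<le> c s"
            using c \<open>0 < \<kappa>\<close> by (auto intro: order_trans[OF less_imp_le])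
        qed (use r \<open>t0 \<le> \<sigma>\<close> in \<open>auto intro!: c_int\<close>)
        also have "\<dots> \<le> 1 / exp 1" using H[of r] r \<open>t0 \<le> \<sigma>\<close> by simp
        finally show ?thesis .
      qed
      show "negligible N" unfolding N_def using N1 N2 N3 N4 N5 by auto
      fix r assume r: "r \<in> {\<sigma>..t} - N"
      show "prob_space (M r) \<and> sets (M r) = sets borel \<and> (AE s in M r. h r \<le> s \<and> s \<le> r)"
        using prob[OF r] .
      have sets[measurable_cong]: "sets (M r) = sets borel" and AE: "AE s in M r. h r \<le> s \<and> s \<le> r"
        using prob[OF r] by auto
      have "(LINT s:{h r..r}|M r. x s) = (LINT s|M r. x s)"
        unfolding set_lebesgue_integral_def
        by (rule integral_cong_AE) (use x_meas in \<open>measurable, auto intro!: eventually_mono[OF AE]\<close>)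
      moreover have "r \<in> {\<sigma>..} - N5" "r \<in> {\<sigma>..t} - N3" "r \<in> {\<sigma>..t} - N4" "r \<in> {t0..} - N2"
        using r \<open>t0 \<le> \<sigma>\<close> by (auto simp: N_def)
      ultimately show "x differentiable at r \<and> \<bar>deriv x r\<bar> \<le> D \<and>
          deriv_from \<sigma> \<psi> x r - a r * deriv_from \<sigma> \<psi> x (g r) + b r * (LINT s|M r. x s) = 0"
        and "\<bar>a r\<bar> \<le> \<alpha> \<and> \<bar>a r\<bar> \<le> p1 * c r \<and> c r \<le> b r \<and> b r \<le> \<omega> \<and>
          b r - c r \<le> q * c r \<and> H r - h r \<le> p2"
        using N5(2)[of r] N3(2)[of r] N4(2)[of r] coef'[of r] by auto
    qed (use \<open>t0 \<le> \<sigma>\<close> \<open>\<sigma> \<le> t\<close> sol1(2) x_meas g h c nonneg \<open>0 \<le> d\<close> \<gamma> \<rho> \<open>0 < \<theta>\<close> in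
        \<open>auto simp: \<theta>_def intro!: c_int\<close>)
    then show ?thesis unfolding \<Phi>_def by (simp add: mult_ac)
  qed
  then show ?thesis
    unfolding exponentially_stable_def using \<open>0 < K\<close> \<gamma>(1) by blast
qed

section \<open>Derivation of stability from each of the three conditions\<close>

theorem theorem5p10:
  fixes t0 a0 \<beta> \<delta> \<tau> :: real
    and a b g h :: "real \<Rightarrow> real"
    and B :: "real \<Rightarrow> real \<Rightarrow> real"
  assumes "t0 \<ge> 0"
    and "a \<in> borel_measurable (lebesgue_on {0..})"
    and "b \<in> borel_measurable (lebesgue_on {0..})"
    and "g \<in> borel_measurable (lebesgue_on {0..})"
    and "h \<in> borel_measurable (lebesgue_on {0..})"
    and "ess_bounded_on {0..} a"
    and "ess_bounded_on {0..} b"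
    and "a0 < 1" and "\<And>t. t \<ge> t0 \<Longrightarrow> \<bar>a t\<bar> \<le> a0"
    and "\<And>t. t \<ge> 0 \<Longrightarrow> b t \<ge> 0"
    and "\<beta> > 0" and "\<And>t. t \<ge> t0 \<Longrightarrow> b t \<ge> \<beta>"
    and "\<And>t. t \<ge> 0 \<Longrightarrow> g t \<le> t"
    and "\<And>t. t \<ge> 0 \<Longrightarrow> h t \<le> t"
    and "filterlim g at_top at_top"
    and "filterlim h at_top at_top"
    and "\<And>E. E \<in> null_sets lebesgue \<Longrightarrow> {t \<in> {0..}. g t \<in> E} \<in> null_sets lebesgue"
    and "\<delta> > 0" and "\<And>t. t \<ge> t0 \<Longrightarrow> t - g t \<le> \<delta>"
    and "\<tau> > 0" and "\<And>t. t \<ge> t0 \<Longrightarrow> t - h t \<le> \<tau>"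
    and "(\<lambda>(t, s). B t s) \<in> borel_measurable (lebesgue_on ({0..} \<times> {0..}))"
    and "AE t in lebesgue_on {0..}. \<forall>s>0. continuous (at_left s) (B t)"
    and "AE t in lebesgue_on {0..}. mono_on ({0..} \<union> {h t}) (zero_ext (B t))"
    and "\<And>s c. s \<ge> 0 \<Longrightarrow> c \<ge> 0 \<Longrightarrow> (\<lambda>t. B t s) absolutely_integrable_on {0..c}"
    and "AE t in lebesgue_on {0..}. zero_ext (B t) (h t) = 0"
    and "AE t in lebesgue_on {0..}. (B t \<longlongrightarrow> 1) (at_right t)"
    and "((\<forall>t\<ge>t0. (LINT s:{h t..t}|lebesgue. zero_ext b s) \<le> 1 / exp 1) \<and>
            ess_norm t0 a + ess_norm t0 b * ess_norm t0 (\<lambda>t. a t / b t) < 1)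
       \<or> (let b0 = (\<lambda>t. min (b t) (1 / (\<tau> * exp 1))) in
            ess_norm t0 (\<lambda>t. a t / b0 t) * (ess_norm t0 b / (1 - ess_norm t0 a))
            + ess_norm t0 (\<lambda>t. (b t - b0 t) / b0 t) < 1)
       \<or> (ess_norm t0 b * (ess_norm t0 (\<lambda>t. a t / b t)
            + ess_norm t0 (\<lambda>t. max (t - h t - 1 / (ess_norm t0 b * exp 1)) 0))
            < 1 - ess_norm t0 a)"
  shows "exponentially_stable t0 a b g h B"
proof -
  note t0 = assms(1) and meas0 = assms(2-5) and b_bd = assms(7) and a0 = assms(8,9)
    and \<beta> = assms(11,12) and g = assms(13,18,19) and h = assms(14,20,21)
    and conditions = assms(28)
  have a_meas[measurable]: "a \<in> borel_measurable (lebesgue_on {t0..})"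
    and b_meas[measurable]: "b \<in> borel_measurable (lebesgue_on {t0..})"
    and h_meas[measurable]: "h \<in> borel_measurable (lebesgue_on {t0..})"
    using meas0(1,2,4)[THEN measurable_restrict_mono, of "{t0..}"] t0 by auto
  have space: "t0 \<le> t" if "t \<in> space (lebesgue_on {t0..})" for t using that by simp
  define \<alpha> where "\<alpha> = ess_norm t0 a"
  define \<omega> where "\<omega> = ess_norm t0 b"
  have "AE t in lebesgue_on {t0..}. \<bar>a t\<bar> \<le> a0" using a0(2) by (intro AE_I2) (auto dest: space)
  note \<alpha> = ess_norm_bounds[OF a_meas this, folded \<alpha>_def]
  have "\<alpha> < 1" using \<alpha>(3) a0(1) by linarith
  obtain C where "AE t in lebesgue_on {0..}. \<bar>b t\<bar> \<le> C"
    using b_bd unfolding ess_bounded_on_def by blast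
  then obtain N0 where N0: "negligible N0" "\<And>t. t \<in> {0..} - N0 \<Longrightarrow> \<bar>b t\<bar> \<le> C"
    by (subst (asm) AE_lebesgue_on_negligible) auto
  then have "AE t in lebesgue_on {t0..}. \<bar>b t\<bar> \<le> C"
    using t0 by (auto simp: AE_lebesgue_on_negligible)
  note \<omega> = ess_norm_bounds[OF b_meas this, folded \<omega>_def]
  \<comment> \<open>The half-line is not null, so some point satisfies both
    \<open>\<beta> \<le> b t\<close> and the almost-everywhere bound by \<omega>.\<close>
  have "\<beta> \<le> \<omega>"
  proof -
    obtain N where N: "negligible N" "\<And>t. t \<in> {t0..} - N \<Longrightarrow> \<bar>b t\<bar> \<le> \<omega>"
      using \<omega>(1) by (auto simp: AE_lebesgue_on_negligible)
    have "\<not> negligible {t0..t0 + 1}" by (simp add: negligible_iff_measure)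
    then have "\<not> {t0..} \<subseteq> N" using N(1) by (meson Icc_subset_Ici_iff negligible_subset order_refl subset_trans)
    then obtain t where "t \<in> {t0..} - N" by blast
    with N(2)[of t] \<beta>(2)[of t] show ?thesis by auto
  qed
  have b_ae: "AE t in lebesgue_on {t0..}. \<bar>a t\<bar> \<le> \<alpha> \<and> b t \<le> \<omega> \<and> \<beta> \<le> b t"
    using \<alpha>(1) \<omega>(1) AE_space by eventually_elim (use \<beta> in \<open>auto dest: space\<close>)
  have ab: "AE t in lebesgue_on {t0..}. \<bar>a t / b t\<bar> \<le> a0 / \<beta>"
  proof (rule AE_I2)
    fix t assume "t \<in> space (lebesgue_on {t0..})"
    then have "t0 \<le> t" by (rule space)
    then show "\<bar>a t / b t\<bar> \<le> a0 / \<beta>"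
      using a0(2)[of t] \<beta>(1) \<beta>(2)[of t] by (auto simp: abs_divide intro!: frac_le)
  qed
  have "(\<lambda>t. a t / b t) \<in> borel_measurable (lebesgue_on {t0..})" by measurable
  note p1 = ess_norm_bounds[OF this ab]
  define p1 where "p1 = ess_norm t0 (\<lambda>t. a t / b t)"
  \<comment> \<open>\<open>b \<le> \<omega>\<close> holds only almost everywhere, while the
    comparison coefficient must be bounded at every time. The truncation alters \<open>b\<close> on
    a null set only, which keeps \<open>q = 0\<close>.\<close>
  define cb where "cb t = min (b t) \<omega>" for t
  have cb_meas: "cb \<in> borel_measurable (lebesgue_on {t0..})" unfolding cb_def by measurable
  have cb_bounds: "\<beta> \<le> cb t \<and> cb t \<le> \<omega>" if "t0 \<le> t" for t
    using \<beta>(2)[OF that] \<open>\<beta> \<le> \<omega>\<close> by (simp add: cb_def)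
  have cb_ae: "AE t in lebesgue_on {t0..}. \<bar>a t\<bar> \<le> \<alpha> \<and> \<bar>a t\<bar> \<le> p1 * cb t \<and> cb t \<le> b t \<and> b t \<le> \<omega> \<and>
      b t - cb t \<le> 0 * cb t"
    using b_ae p1(1)
  proof eventually_elim
    fix t assume t: "\<bar>a t\<bar> \<le> \<alpha> \<and> b t \<le> \<omega> \<and> \<beta> \<le> b t" "\<bar>a t / b t\<bar> \<le> ess_norm t0 (\<lambda>t. a t / b t)"
    then have "\<bar>a t\<bar> \<le> p1 * b t"
      using \<beta>(1) by (simp add: p1_def abs_divide pos_divide_le_eq)
    with t show "\<bar>a t\<bar> \<le> \<alpha> \<and> \<bar>a t\<bar> \<le> p1 * cb t \<and> cb t \<le> b t \<and> b t \<le> \<omega> \<and> b t - cb t \<le> 0 * cb t"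
      by (simp add: cb_def)
  qed
  have integral_le: "integral {max t0 (H t)..t} c \<le> C * D"
    if "\<And>s. t0 \<le> s \<Longrightarrow> 0 \<le> c s \<and> c s \<le> C" "t0 \<le> t" "H t \<le> t" "t - H t \<le> D"
      "c \<in> borel_measurable (lebesgue_on {t0..})" for c H :: "real \<Rightarrow> real" and C D t
  proof -
    have "0 \<le> C" using that(1)[of t] that(2) by linarith
    have "c integrable_on {max t0 (H t)..t}"
    proof (rule measurable_bounded_by_integrable_imp_integrable)
      show "c \<in> borel_measurable (lebesgue_on {max t0 (H t)..t})"
        using that(5) by (rule measurable_restrict_mono) auto
      show "(\<lambda>_. C) integrable_on {max t0 (H t)..t}" by (rule integrable_const_ivl)
    qed (use that(1) in auto)
    then have "integral {max t0 (H t)..t} c \<le> integral {max t0 (H t)..t} (\<lambda>_. C)"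
      using that(1) by (intro integral_le) auto
    also have "\<dots> = C * (t - max t0 (H t))" using that by (simp add: mult.commute)
    also have "\<dots> \<le> C * D" using that \<open>0 \<le> C\<close> by (intro mult_left_mono) auto
    finally show ?thesis .
  qed
  \<comment> \<open>\<open>p\<close>, \<open>q\<close> and \<open>r\<close> bound |a| / c, (b - c) /
    c and the length cut off the delay. One look-back bound has to serve \<open>g\<close> and
    \<open>h\<close> together, hence \<open>max \<delta> \<tau>\<close>.\<close>
  have stableI: "exponentially_stable t0 a b g h B"
    if "c \<in> borel_measurable (lebesgue_on {t0..})" "0 < \<kappa>" "\<And>t. t0 \<le> t \<Longrightarrow> \<kappa> \<le> c t \<and> c t \<le> c1"
      "\<And>t. t0 \<le> t \<Longrightarrow> h t \<le> H t \<and> H t \<le> t" "\<And>t. t0 \<le> t \<Longrightarrow> integral {max t0 (H t)..t} c \<le> 1 / exp 1"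
      "AE t in lebesgue_on {t0..}. \<bar>a t\<bar> \<le> \<alpha> \<and> \<bar>a t\<bar> \<le> p * c t \<and> c t \<le> b t \<and> b t \<le> \<omega> \<and> b t - c t \<le> q * c t"
      "AE t in lebesgue_on {t0..}. H t - h t \<le> r"
      "0 \<le> p" "0 \<le> q" "0 \<le> r" "(p + r) * \<omega> / (1 - \<alpha>) + q < 1" for c H \<kappa> c1 p q r
  proof (rule exponentially_stableI[where c = c and H = H and \<kappa> = \<kappa> and ?c1.0 = c1 and \<alpha> = \<alpha> and \<omega> = \<omega>
        and ?p1.0 = p and ?p2.0 = r and q = q and d = "max \<delta> \<tau>"])
    show "AE t in lebesgue_on {t0..}. \<bar>a t\<bar> \<le> \<alpha> \<and> \<bar>a t\<bar> \<le> p * c t \<and> c t \<le> b t \<and> b t \<le> \<omega> \<and>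
        b t - c t \<le> q * c t \<and> H t - h t \<le> r"
      using that(6,7) by eventually_elim simp
    show "g t \<le> t \<and> t - g t \<le> max \<delta> \<tau>" if "t0 \<le> t" for t
      using g(1)[of t] g(3)[of t] that t0 by (auto simp: le_max_iff_disj)
    show "h t \<le> H t \<and> H t \<le> t \<and> t - h t \<le> max \<delta> \<tau>" if "t0 \<le> t" for t
      using h(3)[of t] \<open>t0 \<le> t \<Longrightarrow> h t \<le> H t \<and> H t \<le> t\<close> that by (auto simp: le_max_iff_disj)
  qed (use t0 g(2) that \<alpha>(2) \<omega>(2) \<open>\<alpha> < 1\<close> assms(17,24,26,27) in auto)
  from conditions show ?thesis
  proof (elim disjE conjE)
    assume i: "\<forall>t\<ge>t0. (LINT s:{h t..t}|lebesgue. zero_ext b s) \<le> 1 / exp 1"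
      and contr: "ess_norm t0 a + ess_norm t0 b * ess_norm t0 (\<lambda>t. a t / b t) < 1"
    \<comment> \<open>The condition itself bounds the integral of \<open>b\<close> over the whole
      delay, so neither coefficient nor delay is reduced and \<open>q = r = 0\<close>.\<close>
    show ?thesis
    proof (rule stableI[where c = cb and \<kappa> = \<beta> and ?c1.0 = \<omega> and H = h and p = p1 and q = 0 and r = 0])
      fix t assume t: "t0 \<le> t"
      \<comment> \<open>A non-integrable function would have set integral 0 and void the assumed
        bound, so integrability is settled beforehand. As \<open>b\<close> is bounded by
        \<open>C\<close> only off \<open>N0\<close>, the minimum with \<open>C\<close> is treated
        and then exchanged for \<open>zero_ext b\<close> off \<open>N0\<close>.\<close>
      have "(\<lambda>s. min (zero_ext b s) C) integrable_on {h t..t}"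
      proof (rule measurable_bounded_by_integrable_imp_integrable)
        have "(\<lambda>s. if s \<in> {0..} then b s else 0) \<in> borel_measurable lebesgue"
          using meas0(2) by (subst borel_measurable_if) auto
        moreover have "(\<lambda>s. if s \<in> {0..} then b s else 0) = zero_ext b"
          by (auto simp: zero_ext_def)
        ultimately have "zero_ext b \<in> borel_measurable lebesgue" by simp
        then show "(\<lambda>s. min (zero_ext b s) C) \<in> borel_measurable (lebesgue_on {h t..t})"
          by (intro borel_measurable_min measurable_restrict_space1) auto
        show "(\<lambda>_. \<bar>C\<bar>) integrable_on {h t..t}" by (rule integrable_const_ivl)
        show "norm (min (zero_ext b s) C) \<le> \<bar>C\<bar>" for s
          using assms(10)[of s] by (auto simp: zero_ext_def min_def)
      qed auto
      then have zb_int: "zero_ext b integrable_on {h t..t}"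
      proof (rule integrable_spike[OF _ N0(1)])
        have "0 \<le> C" using \<omega>(2,3) by linarith
        then show "zero_ext b s = min (zero_ext b s) C" if "s \<in> {h t..t} - N0" for s
          using N0(2)[of s] that by (auto simp: zero_ext_def)
      qed
      have zb_nonneg: "0 \<le> zero_ext b s" for s using assms(10)[of s] by (simp add: zero_ext_def)
      have "integral {max t0 (h t)..t} cb \<le> integral {max t0 (h t)..t} (zero_ext b)"
      proof (rule Henstock_Kurzweil_Integration.integral_le)
        show "cb integrable_on {max t0 (h t)..t}"
        proof (rule measurable_bounded_by_integrable_imp_integrable)
          show "cb \<in> borel_measurable (lebesgue_on {max t0 (h t)..t})"
            using cb_meas by (rule measurable_restrict_mono) auto
          show "(\<lambda>_. \<omega>) integrable_on {max t0 (h t)..t}" by (rule integrable_const_ivl)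
          show "norm (cb s) \<le> \<omega>" if "s \<in> {max t0 (h t)..t}" for s
            using cb_bounds[of s] \<beta>(1) that by auto
        qed auto
        show "zero_ext b integrable_on {max t0 (h t)..t}"
          using zb_int by (rule integrable_on_subinterval) auto
        show "cb s \<le> zero_ext b s" if "s \<in> {max t0 (h t)..t}" for s
          using that t0 by (auto simp: cb_def zero_ext_def)
      qed
      also have "\<dots> \<le> integral {h t..t} (zero_ext b)"
        using zb_nonneg by (intro integral_subset_le zb_int integrable_on_subinterval[OF zb_int]) auto
      also have "\<dots> = (LINT s:{h t..t}|lebesgue. zero_ext b s)"
        using zb_int zb_nonneg
        by (intro set_lebesgue_integral_eq_integral(2)[symmetric] nonnegative_absolutely_integrable_1) auto
      also have "\<dots> \<le> 1 / exp 1" using i t by blast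
      finally show "integral {max t0 (h t)..t} cb \<le> 1 / exp 1" .
    next
      show "(p1 + 0) * \<omega> / (1 - \<alpha>) + 0 < 1"
        using contr \<open>\<alpha> < 1\<close> unfolding p1_def \<alpha>_def \<omega>_def by (simp add: mult.commute)
    qed (use cb_meas cb_bounds cb_ae h \<beta>(1) p1(2) t0 in \<open>auto simp: p1_def\<close>)
  next
    \<comment> \<open>Capping \<open>b\<close> at \<open>1 / (\<tau> * exp 1)\<close> keeps its
      integral over a delay of at most \<tau> below 1 / e without cutting the delay, so
      \<open>r = 0\<close>. The price is the excess \<open>b - b0\<close>, measured by
      \<open>q\<close>.\<close>
    define b0 where "b0 t = min (b t) (1 / (\<tau> * exp 1))" for t
    assume "let b0 = (\<lambda>t. min (b t) (1 / (\<tau> * exp 1))) in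
            ess_norm t0 (\<lambda>t. a t / b0 t) * (ess_norm t0 b / (1 - ess_norm t0 a))
            + ess_norm t0 (\<lambda>t. (b t - b0 t) / b0 t) < 1"
    then have contr: "ess_norm t0 (\<lambda>t. a t / b0 t) * \<omega> / (1 - \<alpha>)
            + ess_norm t0 (\<lambda>t. (b t - b0 t) / b0 t) < 1"
      by (simp add: Let_def b0_def \<alpha>_def \<omega>_def)
    define \<kappa> where "\<kappa> = min \<beta> (1 / (\<tau> * exp 1))"
    have "0 < \<kappa>" using \<beta>(1) h(2) by (simp add: \<kappa>_def)
    have b0_meas[measurable]: "b0 \<in> borel_measurable (lebesgue_on {t0..})" unfolding b0_def by measurable
    have b0: "\<kappa> \<le> b0 t \<and> b0 t \<le> 1 / (\<tau> * exp 1)" if "t0 \<le> t" for t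
      using \<beta>(2)[OF that] by (auto simp: b0_def \<kappa>_def)
    \<comment> \<open>These crude bounds make the two essential norms in the condition
      finite.\<close>
    have bounds: "AE t in lebesgue_on {t0..}. \<bar>a t / b0 t\<bar> \<le> \<alpha> / \<kappa> \<and> \<bar>(b t - b0 t) / b0 t\<bar> \<le> \<omega> / \<kappa>"
      using b_ae AE_space
    proof eventually_elim
      fix t assume t: "\<bar>a t\<bar> \<le> \<alpha> \<and> b t \<le> \<omega> \<and> \<beta> \<le> b t" "t \<in> space (lebesgue_on {t0..})"
      have "\<kappa> \<le> b0 t" "b0 t \<le> b t" using b0[OF space[OF t(2)]] by (auto simp: b0_def)
      then show "\<bar>a t / b0 t\<bar> \<le> \<alpha> / \<kappa> \<and> \<bar>(b t - b0 t) / b0 t\<bar> \<le> \<omega> / \<kappa>"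
        using t(1) \<open>0 < \<kappa>\<close> \<alpha>(2) \<omega>(2) by (auto simp: abs_divide intro!: frac_le)
    qed
    have p_meas: "(\<lambda>t. a t / b0 t) \<in> borel_measurable (lebesgue_on {t0..})" by measurable
    have "AE t in lebesgue_on {t0..}. \<bar>a t / b0 t\<bar> \<le> \<alpha> / \<kappa>"
      using bounds by eventually_elim simp
    note p = ess_norm_bounds[OF p_meas this]
    have q_meas: "(\<lambda>t. (b t - b0 t) / b0 t) \<in> borel_measurable (lebesgue_on {t0..})" by measurable
    have "AE t in lebesgue_on {t0..}. \<bar>(b t - b0 t) / b0 t\<bar> \<le> \<omega> / \<kappa>"
      using bounds by eventually_elim simp
    note q = ess_norm_bounds[OF q_meas this]
    show ?thesis
    proof (rule stableI[where c = b0 and \<kappa> = \<kappa> and ?c1.0 = "1 / (\<tau> * exp 1)" and H = h and r = 0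
          and p = "ess_norm t0 (\<lambda>t. a t / b0 t)" and q = "ess_norm t0 (\<lambda>t. (b t - b0 t) / b0 t)"])
      show "AE t in lebesgue_on {t0..}. \<bar>a t\<bar> \<le> \<alpha> \<and> \<bar>a t\<bar> \<le> ess_norm t0 (\<lambda>t. a t / b0 t) * b0 t \<and>
          b0 t \<le> b t \<and> b t \<le> \<omega> \<and> b t - b0 t \<le> ess_norm t0 (\<lambda>t. (b t - b0 t) / b0 t) * b0 t"
        using b_ae p(1) q(1) AE_space
      proof eventually_elim
        fix t assume t: "\<bar>a t\<bar> \<le> \<alpha> \<and> b t \<le> \<omega> \<and> \<beta> \<le> b t" "\<bar>a t / b0 t\<bar> \<le> ess_norm t0 (\<lambda>t. a t / b0 t)"
          "\<bar>(b t - b0 t) / b0 t\<bar> \<le> ess_norm t0 (\<lambda>t. (b t - b0 t) / b0 t)" "t \<in> space (lebesgue_on {t0..})"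
        have "0 < b0 t" using b0[OF space[OF t(4)]] \<open>0 < \<kappa>\<close> by linarith
        moreover have "b0 t \<le> b t" by (simp add: b0_def)
        ultimately show "\<bar>a t\<bar> \<le> \<alpha> \<and> \<bar>a t\<bar> \<le> ess_norm t0 (\<lambda>t. a t / b0 t) * b0 t \<and>
          b0 t \<le> b t \<and> b t \<le> \<omega> \<and> b t - b0 t \<le> ess_norm t0 (\<lambda>t. (b t - b0 t) / b0 t) * b0 t"
          using t(1-3) by (simp add: abs_divide pos_divide_le_eq)
      qed
      fix t assume t: "t0 \<le> t"
      have "integral {max t0 (h t)..t} b0 \<le> 1 / (\<tau> * exp 1) * \<tau>"
        using t h t0 \<open>0 < \<kappa>\<close> b0 b0_meas by (intro integral_le) (auto intro: order_trans[OF less_imp_le])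
      then show "integral {max t0 (h t)..t} b0 \<le> 1 / exp 1" using h(2) by simp
    qed (use b0 \<open>0 < \<kappa>\<close> h contr p(2) q(2) t0 in auto)
  next
    \<comment> \<open>Here the coefficient is kept and the delay is cut to
      \<open>1 / (\<omega> * exp 1)\<close>, over which \<open>cb \<le> \<omega>\<close> integrates
      to at most 1 / e. The length \<open>H t - h t\<close> cut off is exactly the positive part in
      the condition, so its norm is the cost \<open>p2\<close>.\<close>
    define H where "H t = max (h t) (t - 1 / (\<omega> * exp 1))" for t
    define p2 where "p2 = ess_norm t0 (\<lambda>t. max (t - h t - 1 / (\<omega> * exp 1)) 0)"
    assume "ess_norm t0 b * (ess_norm t0 (\<lambda>t. a t / b t)
            + ess_norm t0 (\<lambda>t. max (t - h t - 1 / (ess_norm t0 b * exp 1)) 0))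
            < 1 - ess_norm t0 a"
    then have contr: "\<omega> * (p1 + p2) < 1 - \<alpha>" unfolding \<omega>_def p1_def p2_def \<alpha>_def .
    have "0 < \<omega>" using \<beta>(1) \<open>\<beta> \<le> \<omega>\<close> by linarith
    then have "0 < 1 / (\<omega> * exp 1)" by simp
    have "(\<lambda>t. t) \<in> borel_measurable (lebesgue_on {t0..})"
      by (intro measurable_restrict_space1 measurable_completion) simp
    then have "(\<lambda>t. max (t - h t - 1 / (\<omega> * exp 1)) 0) \<in> borel_measurable (lebesgue_on {t0..})"
      by (intro borel_measurable_max borel_measurable_diff h_meas borel_measurable_const)
    moreover have "AE t in lebesgue_on {t0..}. \<bar>max (t - h t - 1 / (\<omega> * exp 1)) 0\<bar> \<le> \<tau>"
    proof (rule AE_I2)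
      fix t assume "t \<in> space (lebesgue_on {t0..})"
      then have "t - h t \<le> \<tau>" by (intro h(3) space)
      then show "\<bar>max (t - h t - 1 / (\<omega> * exp 1)) 0\<bar> \<le> \<tau>"
        using \<open>0 < 1 / (\<omega> * exp 1)\<close> h(2) by arith
    qed
    ultimately have p2: "AE t in lebesgue_on {t0..}. \<bar>max (t - h t - 1 / (\<omega> * exp 1)) 0\<bar> \<le> p2" "0 \<le> p2"
      unfolding p2_def by (rule ess_norm_bounds)+
    show ?thesis
    proof (rule stableI[where c = cb and \<kappa> = \<beta> and ?c1.0 = \<omega> and H = H and p = p1 and q = 0 and r = p2])
      show "AE t in lebesgue_on {t0..}. H t - h t \<le> p2"
        using p2(1) by eventually_elim (auto simp: H_def max_def split: if_splits)
      show "(p1 + p2) * \<omega> / (1 - \<alpha>) + 0 < 1"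
        using contr \<open>\<alpha> < 1\<close> by (simp add: mult.commute)
      fix t assume t: "t0 \<le> t"
      then have "h t \<le> t" using h(1) t0 by simp
      then show H: "h t \<le> H t \<and> H t \<le> t"
        using \<open>0 < 1 / (\<omega> * exp 1)\<close> by (simp add: H_def)
      have "integral {max t0 (H t)..t} cb \<le> \<omega> * (1 / (\<omega> * exp 1))"
        using t H cb_bounds cb_meas \<beta>(1)
        by (intro integral_le) (auto simp: H_def intro: order_trans[OF less_imp_le])
      then show "integral {max t0 (H t)..t} cb \<le> 1 / exp 1" using \<open>0 < \<omega>\<close> by simp
    qed (use cb_meas cb_bounds cb_ae \<beta>(1) p1(2) p2(2) in \<open>auto simp: p1_def\<close>)
  qed
qed

end
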